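(* Let $n\ge 3$. Choose a set $\mathcal{C}$ of circuits of $K_n$ containing exactly one circuit traversing each standard cycle of $K_n$ (of any length $\ge 3$). Then the elements $\{L_C, L'_C\}_{C\in\mathcal{C}}$ of $E_2$ are linearly independent over $\mathbb{Q}$. Consequently, for every $q\ge1$, \[\dim_{\mathbb{Q}} E_3^{1,q}\ \ge\ 2\binom{n}{q+2}\,q!.\]
   Context: Let $E$ be a complex elliptic curve, $x,y$ a basis of $H^1(E;\mathbb{Q})$ with $xy$ generating $H^2(E;\mathbb{Q})$, and $C(n)\subset E^n$ the configuration space of $n$ distinct ordered points of $E$. Let $E_2=E_2^{\bullet,\bullet}$ (with differential $d_2$) be the second page of the rational Leray spectral sequence of $C(n)\hookrightarrow E^n$: the quotient of the free graded-commutative algebra (for total degree) over $\mathbb{Q}$ on $x_i,y_i$ ($1\le i\le n$), bidegree $(1,0)$, and $\omega_{ij}=\omega_{ji}$ ($i\ne j$), bidegree $(0,1)$, by the relations $(x_i-x_j)\omega_{ij}=0$, $(y_i-y_j)\omega_{ij}=0$, $\omega_{ij}\omega_{jk}+\omega_{jk}\omega_{ki}+\omega_{ki}\omega_{ij}=0$ (distinct $i,j,k$); $d_2$ is the derivation of bidegree $(2,-1)$ with $d_2x_i=d_2y_i=0$, $d_2\omega_{ij}=(x_i-x_j)(y_i-y_j)$. The third page is $E_3^{p,q}=\ker(d_2:E_2^{p,q}\to E_2^{p+2,q-1})/\operatorname{im}(d_2:E_2^{p-2,q+1}\to E_2^{p,q})$. A circuit of length $k\ge3$ in $K_n$ is a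 sequence $C=(c_1,\dots,c_k)$ of oriented edges (source $s(c)$, target $t(c)$) with $t(c_i)=s(c_{i+1})$, $t(c_k)=s(c_1)$ and pairwise distinct $s(c_i)$; it traverses the (unoriented) simple cycle formed by its edges. A cycle (or circuit) is standard if its two greatest vertices are adjacent in it. With $\omega_c=\omega_{s(c),t(c)}$ and $\omega_{C\setminus\{c_i,c_j\}}$ the product of the $\omega_{c_m}$, $m\notin\{i,j\}$, in increasing order of $m$, set $L_C=\sum_{1\le i<j\le k}(-1)^{i+j}(x_{t(c_i)}-x_{s(c_i)})\omega_{C\setminus\{c_i,c_j\}}$ and $L'_C=\sum_{1\le i<j\le k}(-1)^{i+j}(y_{t(c_i)}-y_{s(c_i)})\omega_{C\setminus\{c_i,c_j\}}$, elements of $E_2^{1,k-2}$ lying in $\ker d_2$. *)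

theory Defs
  imports Complex_Main "HOL-Library.Function_Algebras" "HOL-Library.Nat_Bijection"
begin

text \<open>All generators x_i, y_i (bidegree (1,0)) and w_ij (bidegree (0,1)) have odd total
degree 1, so the free graded-commutative Q-algebra on them is the exterior algebra.
An element is a rational-valued function on finite sets of generators (a set U stands for
the monomial given by the product of its elements in increasing rank order).
The generator w_ij = w_ji is represented by W (min i j) (max i j).\<close>

datatype gen = X nat | Y nat | W nat nat

fun rank :: "gen \<Rightarrow> nat" where
  "rank (X i) = 3 * i"
| "rank (Y i) = 3 * i + 1"
| "rank (W i j) = 3 * prod_encode (i, j) + 2"

fun isW :: "gen \<Rightarrow> bool" where
  "isW (W i j) = True"
| "isW _ = False"

definition Gens :: "nat \<Rightarrow> gen set" where
  "Gens n = {X i | i. i \<in> {1..n}} \<union> {Y i | i. i \<in> {1..n}}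
            \<union> {W i j | i j. 1 \<le> i \<and> i < j \<and> j \<le> n}"

type_synonym elt = "gen set \<Rightarrow> rat"

definition Lam :: "nat \<Rightarrow> elt set" where
  "Lam n = {f. \<forall>U. f U \<noteq> 0 \<longrightarrow> U \<subseteq> Gens n}"

text \<open>Bihomogeneous part of bidegree (p,q) (p may be negative, then only 0).\<close>
definition Lam_bideg :: "nat \<Rightarrow> int \<Rightarrow> nat \<Rightarrow> elt set" where
  "Lam_bideg n p q = {f. \<forall>U. f U \<noteq> 0 \<longrightarrow>
      U \<subseteq> Gens n \<and> int (card {g\<in>U. \<not> isW g}) = p \<and> card {g\<in>U. isW g} = q}"

definition sc :: "rat \<Rightarrow> elt \<Rightarrow> elt" where
  "sc c f = (\<lambda>U. c * f U)"

text \<open>Sign of reordering mono(S) * mono(T) into mono(S \<union> T).\<close>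
definition esign :: "gen set \<Rightarrow> gen set \<Rightarrow> rat" where
  "esign S T = (-1) ^ card {(a, b). a \<in> S \<and> b \<in> T \<and> rank b < rank a}"

definition emul :: "elt \<Rightarrow> elt \<Rightarrow> elt" where
  "emul f g = (\<lambda>U. \<Sum>S\<in>Pow U. esign S (U - S) * f S * g (U - S))"

definition eone :: elt where
  "eone = (\<lambda>U. if U = {} then 1 else 0)"

definition egen :: "gen \<Rightarrow> elt" where
  "egen g = (\<lambda>U. if U = {g} then 1 else 0)"

definition mono :: "gen set \<Rightarrow> elt" where
  "mono V = (\<lambda>U. if U = V then 1 else 0)"

definition xg :: "nat \<Rightarrow> elt" where "xg i = egen (X i)"
definition yg :: "nat \<Rightarrow> elt" where "yg i = egen (Y i)"
definition wg :: "nat \<Rightarrow> nat \<Rightarrow> elt" where "wg i j = egen (W (min i j) (max i j))"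

definition eprod :: "elt list \<Rightarrow> elt" where
  "eprod fs = foldr emul fs eone"

definition rels :: "nat \<Rightarrow> elt set" where
  "rels n =
     {emul (xg i - xg j) (wg i j) | i j. i \<in> {1..n} \<and> j \<in> {1..n} \<and> i \<noteq> j}
   \<union> {emul (yg i - yg j) (wg i j) | i j. i \<in> {1..n} \<and> j \<in> {1..n} \<and> i \<noteq> j}
   \<union> {emul (wg i j) (wg j k) + emul (wg j k) (wg k i) + emul (wg k i) (wg i j) | i j k.
        i \<in> {1..n} \<and> j \<in> {1..n} \<and> k \<in> {1..n} \<and> i \<noteq> j \<and> j \<noteq> k \<and> i \<noteq> k}"

text \<open>The (two-sided, since graded-commutative and generated by homogeneous elements)
ideal generated by the relations; E_2 = Lam n / Ideal n.\<close>
definition Ideal :: "nat \<Rightarrow> elt set" where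
  "Ideal n = module.span sc {emul a r | a r. a \<in> Lam n \<and> r \<in> rels n}"

definition dgen :: "gen \<Rightarrow> elt" where
  "dgen g = (case g of W i j \<Rightarrow> emul (xg i - xg j) (yg i - yg j) | _ \<Rightarrow> 0)"

text \<open>d_2 is a derivation of odd total degree; since d_2(w) has even degree it commutes
with everything, so d(g_1...g_m) = sum_k (-1)^(k-1) d(g_k) g_1..(omit g_k)..g_m.\<close>
definition dmono :: "gen set \<Rightarrow> elt" where
  "dmono U = (\<Sum>w\<in>{w\<in>U. isW w}.
      sc ((-1) ^ card {u\<in>U. rank u < rank w}) (emul (dgen w) (mono (U - {w}))))"

definition d2 :: "nat \<Rightarrow> elt \<Rightarrow> elt" where
  "d2 n f = (\<Sum>U\<in>Pow (Gens n). sc (f U) (dmono U))"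

definition Zrep :: "nat \<Rightarrow> int \<Rightarrow> nat \<Rightarrow> elt set" where
  "Zrep n p q = {f \<in> Lam_bideg n p q. d2 n f \<in> Ideal n}"

definition Brep :: "nat \<Rightarrow> int \<Rightarrow> nat \<Rightarrow> elt set" where
  "Brep n p q = {a + d2 n b | a b. a \<in> Ideal n \<inter> Lam_bideg n p q \<and> b \<in> Lam_bideg n (p - 2) (q + 1)}"

text \<open>dim_Q E_3^{p,q} = dim (Zrep / Brep) = dim Zrep - dim Brep (finite-dimensional, Brep \<subseteq> Zrep).\<close>
definition E3_dim :: "nat \<Rightarrow> int \<Rightarrow> nat \<Rightarrow> nat" where
  "E3_dim n p q = vector_space.dim sc (Zrep n p q) - vector_space.dim sc (Brep n p q)"

text \<open>A circuit (c_1,...,c_k) is encoded by the list of sources [v_1,...,v_k] (0-indexed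
here): c_i = (v_i, v_{i+1 mod k}).\<close>
definition is_circuit :: "nat \<Rightarrow> nat list \<Rightarrow> bool" where
  "is_circuit n vs \<longleftrightarrow> length vs \<ge> 3 \<and> distinct vs \<and> set vs \<subseteq> {1..n}"

definition csrc :: "nat list \<Rightarrow> nat \<Rightarrow> nat" where
  "csrc vs m = vs ! m"
definition ctgt :: "nat list \<Rightarrow> nat \<Rightarrow> nat" where
  "ctgt vs m = vs ! ((m + 1) mod length vs)"

definition cycle_of :: "nat list \<Rightarrow> nat set set" where
  "cycle_of vs = {{csrc vs m, ctgt vs m} | m. m < length vs}"

definition is_cycle :: "nat \<Rightarrow> nat set set \<Rightarrow> bool" where
  "is_cycle n Z \<longleftrightarrow> (\<exists>vs. is_circuit n vs \<and> cycle_of vs = Z)"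

definition standard_cycle :: "nat set set \<Rightarrow> bool" where
  "standard_cycle Z \<longleftrightarrow> (let V = \<Union>Z; a = Max V; b = Max (V - {a}) in {a, b} \<in> Z)"

definition omega_c :: "nat list \<Rightarrow> nat \<Rightarrow> elt" where
  "omega_c vs m = wg (csrc vs m) (ctgt vs m)"

definition omega_minus :: "nat list \<Rightarrow> nat \<Rightarrow> nat \<Rightarrow> elt" where
  "omega_minus vs i j = eprod (map (omega_c vs) (filter (\<lambda>m. m \<noteq> i \<and> m \<noteq> j) [0..<length vs]))"

definition L_C :: "nat list \<Rightarrow> elt" where
  "L_C vs = (\<Sum>(i, j)\<in>{(i, j). i < j \<and> j < length vs}.
     sc ((-1) ^ (i + j)) (emul (xg (ctgt vs i) - xg (csrc vs i)) (omega_minus vs i j)))"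

definition L'_C :: "nat list \<Rightarrow> elt" where
  "L'_C vs = (\<Sum>(i, j)\<in>{(i, j). i < j \<and> j < length vs}.
     sc ((-1) ^ (i + j)) (emul (yg (ctgt vs i) - yg (csrc vs i)) (omega_minus vs i j)))"

definition LL_independent :: "nat \<Rightarrow> nat list set \<Rightarrow> bool" where
  "LL_independent n CC \<longleftrightarrow>
     (\<forall>a b :: nat list \<Rightarrow> rat.
        (\<Sum>C\<in>CC. sc (a C) (L_C C) + sc (b C) (L'_C C)) \<in> Ideal n
        \<longrightarrow> (\<forall>C\<in>CC. a C = 0 \<and> b C = 0))"

end

theory Submission
  imports Defs "HOL-Combinatorics.Multiset_Permutations"
begin

text \<open>
  Let \<open>a > b\<close> be the two greatest vertices of a standard cycle, written as \<open>a, s\<^sub>0, \<dots>, s\<^sub>K\<^sub>-\<^sub>1\<close> with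
  \<open>s\<^sub>0 = b\<close>. Send \<open>x\<^sub>a\<close> to an exterior generator \<open>u\<^sub>0\<close>, all other \<open>x\<^sub>i\<close> and all \<open>y\<^sub>i\<close> to \<open>0\<close>, and an edge
  generator with endpoints \<open>s\<^sub>i, s\<^sub>j\<close>, \<open>i < j\<close>, to \<open>u\<^sub>j\<close> (to \<open>0\<close> if an endpoint is not among the \<open>s\<^sub>i\<close>).
  This respects all relations, so the coefficient of \<open>u\<^sub>0 \<dots> u\<^sub>K\<^sub>-\<^sub>1\<close> is a linear functional on the second
  page. In \<open>L\<^sub>C\<close> it sees only the summand in which the two edges at \<open>a\<close> are deleted and \<open>a\<close> is an
  endpoint of the edge in the linear factor; what remains is a path on the other vertices starting
  at \<open>b\<close>, and its label product is nonzero only for the path \<open>s\<^sub>0, \<dots>, s\<^sub>K\<^sub>-\<^sub>1\<close>. Hence these functionals (and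
  their \<open>y\<close>-analogues) are dual, up to nonzero scalars, to the elements \<open>L\<^sub>C\<close> and \<open>L'\<^sub>C\<close>. The dimension bound follows
  because these elements are cocycles, there are no boundaries in bidegree \<open>(1, q)\<close>, and there
  are \<open>q!\<close> standard cycles on each set of \<open>q + 2\<close> vertices.
\<close>

subsection \<open>The exterior algebra\<close>

text \<open>The quotient is never given a basis: functionals on the exterior algebra that vanish on
  the ideal are enough for independence. The labels are shaped by the relations. In an Arnold
  relation two of the three edges should be indistinguishable, and taking the maximum of the
  positions achieves this at the vertex of greatest position. Two distinct vertices of the path
  never have maximal position 0, so no edge competes with \<open>x\<^sub>a\<close> for
  \<open>u\<^sub>0\<close>. Standardness removes the false positives. A path with
  \<open>s\<^sub>0\<close> in its interior can also have a nonzero label product: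
  \<open>s\<^sub>1, s\<^sub>0, s\<^sub>2\<close> has edge labels 1 and 2. A standard circuit through
  exactly the vertices in question contains the edge from \<open>a\<close> to
  \<open>b = s\<^sub>0\<close>, so deleting \<open>a\<close> leaves a path with
  \<open>s\<^sub>0\<close> at its end. The pairing matrix is then diagonal, not merely triangular,
  and only the nonvanishing of its diagonal matters, so the signs of the entries are never
  computed.\<close>

interpretation ev: vector_space sc
  by standard (auto simp: sc_def fun_eq_iff algebra_simps)

text \<open>The residue modulo 3 separates the three kinds of generators, so ordering by
  \<open>rank\<close> is strict and total.\<close>

lemma rank_eq_iff [simp]: "rank g = rank h \<longleftrightarrow> g = h"
proof
  assume "rank g = rank h"
  then show "g = h"
    by (cases g; cases h) (simp_all, presburger+)
qed simp

text \<open>Inversions add up over disjoint unions. This rule and its mirror image are all that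
  associativity needs to know about signs.\<close>

lemma esign_union_left:
  assumes "finite A" "finite B" "finite C" "A \<inter> B = {}"
  shows "esign (A \<union> B) C = esign A C * esign B C"
proof -
  have "{(a, b). a \<in> A \<union> B \<and> b \<in> C \<and> rank b < rank a}
      = {(a, b). a \<in> A \<and> b \<in> C \<and> rank b < rank a} \<union> {(a, b). a \<in> B \<and> b \<in> C \<and> rank b < rank a}"
    by auto
  moreover have "finite {(a, b). a \<in> A \<and> b \<in> C \<and> rank b < rank a}"
    by (rule finite_subset[of _ "A \<times> C"]) (use assms in auto)
  moreover have "finite {(a, b). a \<in> B \<and> b \<in> C \<and> rank b < rank a}"
    by (rule finite_subset[of _ "B \<times> C"]) (use assms in auto)
  ultimately show ?thesis
    unfolding esign_def using assms(4) by (subst power_add[symmetric], subst card_Un_disjoint[symmetric]) auto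
qed

lemma esign_union_right:
  assumes "finite A" "finite B" "finite C" "A \<inter> B = {}"
  shows "esign C (A \<union> B) = esign C A * esign C B"
proof -
  have "{(a, b). a \<in> C \<and> b \<in> A \<union> B \<and> rank b < rank a}
      = {(a, b). a \<in> C \<and> b \<in> A \<and> rank b < rank a} \<union> {(a, b). a \<in> C \<and> b \<in> B \<and> rank b < rank a}"
    by auto
  moreover have "finite {(a, b). a \<in> C \<and> b \<in> A \<and> rank b < rank a}"
    by (rule finite_subset[of _ "C \<times> A"]) (use assms in auto)
  moreover have "finite {(a, b). a \<in> C \<and> b \<in> B \<and> rank b < rank a}"
    by (rule finite_subset[of _ "C \<times> B"]) (use assms in auto)
  ultimately show ?thesis
    unfolding esign_def using assms(4) by (subst power_add[symmetric], subst card_Un_disjoint[symmetric]) auto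
qed

lemma esign_empty_right [simp]: "esign S {} = 1"
  by (simp add: esign_def)

text \<open>For infinite \<open>U\<close> the sum over \<open>Pow U\<close> has an infinite index
  set and defaults to 0. Associativity therefore holds for arbitrary functions, not only on
  \<open>Lam n\<close>.\<close>

lemma emul_infinite: "infinite U \<Longrightarrow> emul f g U = 0"
  by (simp add: emul_def)

lemma emul_assoc: "emul (emul f g) h = emul f (emul g h)"
proof
  fix U :: "gen set"
  show "emul (emul f g) h U = emul f (emul g h) U"
  proof (cases "finite U")
    case fin: True
    have "emul (emul f g) h U = (\<Sum>S\<in>Pow U. \<Sum>R\<in>Pow S.
        esign S (U - S) * (esign R (S - R) * f R * g (S - R)) * h (U - S))"
      by (simp add: emul_def sum_distrib_left sum_distrib_right)
    also have "\<dots> = (\<Sum>(S, R)\<in>(SIGMA S:Pow U. Pow S).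
        esign S (U - S) * (esign R (S - R) * f R * g (S - R)) * h (U - S))"
      by (rule sum.Sigma) (use fin finite_subset in auto)
    \<comment> \<open>A chain R \<subseteq> S \<subseteq> U is the same as a splitting of U into R,
      Q = S - R and the rest; both bracketings carry the inversions between all three pairs of
      pieces.\<close>
    also have "\<dots> = (\<Sum>(R, Q)\<in>(SIGMA R:Pow U. Pow (U - R)).
        esign R (U - R) * f R * (esign Q (U - R - Q) * g Q * h (U - R - Q)))"
    proof (rule sum.reindex_bij_witness[where i = "\<lambda>(R, Q). (R \<union> Q, R)" and j = "\<lambda>(S, R). (R, S - R)"],
        goal_cases)
      case (5 p)
      obtain S R where p: "p = (S, R)" by (cases p)
      with 5 have sub: "S \<subseteq> U" "R \<subseteq> S" by auto
      have finS: "finite S" by (rule finite_subset[OF sub(1) fin])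
      moreover have finR: "finite R" by (rule finite_subset[OF sub(2) finS])
      ultimately have fins: "finite (S - R)" "finite (U - S)" "finite R" using fin by auto
      have unS: "R \<union> (S - R) = S" and unU: "(S - R) \<union> (U - S) = U - R" using sub by auto
      have "esign S (U - S) = esign R (U - S) * esign (S - R) (U - S)"
        using esign_union_left[of R "S - R" "U - S"] fins unS by auto
      moreover have "esign R (U - R) = esign R (S - R) * esign R (U - S)"
        using esign_union_right[of "S - R" "U - S" R] fins unU by auto
      moreover have "U - R - (S - R) = U - S" using sub by auto
      ultimately show ?case by (simp add: p)
    qed auto
    also have "\<dots> = emul f (emul g h) U"
      unfolding emul_def sum_distrib_left
      by (subst sum.Sigma[symmetric]) (use fin finite_subset in auto)
    finally show ?thesis .
  qed (simp add: emul_infinite)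
qed

lemma emul_add_left: "emul (f + g) h = emul f h + emul g h"
  by (auto simp: emul_def fun_eq_iff algebra_simps sum.distrib)
lemma emul_add_right: "emul h (f + g) = emul h f + emul h g"
  by (auto simp: emul_def fun_eq_iff algebra_simps sum.distrib)
lemma emul_diff_left: "emul (f - g) h = emul f h - emul g h"
  by (auto simp: emul_def fun_eq_iff algebra_simps sum_subtractf)
lemma emul_diff_right: "emul h (f - g) = emul h f - emul h g"
  by (auto simp: emul_def fun_eq_iff algebra_simps sum_subtractf)
lemma emul_minus_left: "emul (- f) h = - emul f h"
  by (auto simp: emul_def fun_eq_iff sum_negf)
lemma emul_minus_right: "emul h (- f) = - emul h f"
  by (auto simp: emul_def fun_eq_iff sum_negf)
lemma emul_zero_left [simp]: "emul 0 h = 0"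
  by (auto simp: emul_def fun_eq_iff)
lemma emul_zero_right [simp]: "emul h 0 = 0"
  by (auto simp: emul_def fun_eq_iff)
lemma emul_sc_left: "emul (sc c f) h = sc c (emul f h)"
  by (auto simp: emul_def sc_def fun_eq_iff sum_distrib_left mult_ac)
lemma emul_sc_right: "emul h (sc c f) = sc c (emul h f)"
  by (auto simp: emul_def sc_def fun_eq_iff sum_distrib_left mult_ac)
lemma emul_sum_left: "emul (\<Sum>i\<in>I. f i) h = (\<Sum>i\<in>I. emul (f i) h)"
  by (induction I rule: infinite_finite_induct)
    (simp_all only: sum.infinite sum.empty sum.insert emul_zero_left emul_add_left not_False_eq_True)
lemma emul_sum_right: "emul h (\<Sum>i\<in>I. f i) = (\<Sum>i\<in>I. emul h (f i))"
  by (induction I rule: infinite_finite_induct)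
    (simp_all only: sum.infinite sum.empty sum.insert emul_zero_right emul_add_right not_False_eq_True)

lemmas emul_linear = emul_add_left emul_add_right emul_diff_left emul_diff_right
  emul_minus_left emul_minus_right emul_sc_left emul_sc_right emul_sum_left emul_sum_right

lemma emul_egen_left:
  assumes "finite U"
  shows "emul (egen g) f U = (if g \<in> U then (-1) ^ card {u\<in>U. rank u < rank g} * f (U - {g}) else 0)"
proof -
  have "emul (egen g) f U = (\<Sum>S\<in>Pow U. if S = {g} then esign {g} (U - {g}) * f (U - {g}) else 0)"
    unfolding emul_def egen_def by (rule sum.cong) auto
  also have "\<dots> = (if g \<in> U then esign {g} (U - {g}) * f (U - {g}) else 0)"
    using assms by (simp add: sum.delta)
  also have "{(a, b). a \<in> {g} \<and> b \<in> U - {g} \<and> rank b < rank a} = Pair g ` {u\<in>U. rank u < rank g}"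
    by auto
  then have "esign {g} (U - {g}) = (-1) ^ card {u\<in>U. rank u < rank g}"
    by (simp add: esign_def card_image inj_on_def)
  finally show ?thesis by simp
qed

lemma emul_egen_right:
  assumes "finite U"
  shows "emul f (egen g) U = (if g \<in> U then (-1) ^ card {u\<in>U. rank g < rank u} * f (U - {g}) else 0)"
proof -
  have "emul f (egen g) U = (\<Sum>S\<in>Pow U. if S = U - {g} then (if g \<in> U then esign (U - {g}) {g} * f (U - {g}) else 0) else 0)"
    unfolding emul_def egen_def
  proof (rule sum.cong)
    fix S assume "S \<in> Pow U"
    then have "U - S = {g} \<longleftrightarrow> S = U - {g} \<and> g \<in> U" by auto
    then show "esign S (U - S) * f S * (if U - S = {g} then 1 else 0) =
         (if S = U - {g} then if g \<in> U then esign (U - {g}) {g} * f (U - {g}) else 0 else 0)"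
      by auto
  qed simp
  also have "\<dots> = (if g \<in> U then esign (U - {g}) {g} * f (U - {g}) else 0)"
    using assms by (simp add: sum.delta)
  also have "{(a, b). a \<in> U - {g} \<and> b \<in> {g} \<and> rank b < rank a} = (\<lambda>u. (u, g)) ` {u\<in>U. rank g < rank u}"
    by auto
  then have "esign (U - {g}) {g} = (-1) ^ card {u\<in>U. rank g < rank u}"
    by (simp add: esign_def card_image inj_on_def)
  finally show ?thesis by simp
qed

section \<open>Sign rules for elements of total degree one\<close>

definition deg1 :: "elt \<Rightarrow> bool" where
  "deg1 f \<longleftrightarrow> (\<forall>U. f U \<noteq> 0 \<longrightarrow> (\<exists>g. U = {g}))"

lemma deg1_egen [simp]: "deg1 (egen g)"
  by (auto simp: deg1_def egen_def)
lemma deg1_diff [simp]: "deg1 f \<Longrightarrow> deg1 g \<Longrightarrow> deg1 (f - g)"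
  unfolding deg1_def fun_diff_def by (metis diff_self)

lemma deg1_anticommute:
  assumes "deg1 f" "deg1 g"
  shows "emul f g = - emul g f"
proof
  fix U
  have "emul f g U = (\<Sum>S\<in>Pow U. - (esign S (U - S) * g S * f (U - S)))"
    unfolding emul_def
  proof (rule sum.reindex_bij_witness[where i = "\<lambda>S. U - S" and j = "\<lambda>S. U - S"], goal_cases)
    case (5 S)
    show ?case
    proof (cases "f S = 0 \<or> g (U - S) = 0")
      case False
      then obtain a b where ab: "S = {a}" "U - S = {b}"
        using assms unfolding deg1_def by meson
      then have "a \<noteq> b" by auto
      then have ne: "rank a \<noteq> rank b" by simp
      have "{(c, d). c \<in> {b} \<and> d \<in> {a} \<and> rank d < rank c} = (if rank a < rank b then {(b, a)} else {})" for a b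
        by auto
      then have s: "esign {b} {a} = (if rank a < rank b then -1 else 1)" for a b
        by (simp add: esign_def)
      from 5 have "U - (U - S) = S" by auto
      then show ?thesis using ab s[of a b] s[of b a] ne by auto
    next
      case True
      from 5 have "U - (U - S) = S" by auto
      with True show ?thesis by auto
    qed
  qed auto
  then show "emul f g U = (- emul g f) U"
    by (simp add: emul_def sum_negf)
qed

text \<open>Anticommuting with itself makes the square equal to its negative, and the coefficients
  are rational.\<close>

lemma deg1_square: 
  assumes "deg1 f"
  shows "emul f f = 0"
  using deg1_anticommute[OF assms assms] by (simp add: fun_eq_iff)

lemma deg1_left_commute:
  assumes "deg1 f" "deg1 g"
  shows "emul f (emul g h) = - emul g (emul f h)"
  by (metis assms deg1_anticommute emul_assoc emul_minus_left)

lemma deg1_square_left: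
  assumes "deg1 f"
  shows "emul f (emul f h) = 0"
  by (metis assms deg1_square emul_assoc emul_zero_left)

section \<open>The free graded-commutative algebra as a subspace\<close>

lemma finite_Gens [simp]: "finite (Gens n)"
proof -
  have "Gens n \<subseteq> X ` {1..n} \<union> Y ` {1..n} \<union> case_prod W ` ({1..n} \<times> {1..n})"
    by (force simp: Gens_def)
  then show ?thesis by (rule finite_subset) auto
qed

lemma LamD: "f \<in> Lam n \<Longrightarrow> f U \<noteq> 0 \<Longrightarrow> U \<subseteq> Gens n"
  by (auto simp: Lam_def)

lemma LamD_finite: "f \<in> Lam n \<Longrightarrow> f U \<noteq> 0 \<Longrightarrow> finite U"
  using LamD finite_Gens finite_subset by metis

lemma subspace_Lam: "ev.subspace (Lam n)"
proof (rule ev.subspaceI)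
  fix f g assume fg: "f \<in> Lam n" "g \<in> Lam n"
  have "U \<subseteq> Gens n" if "(f + g) U \<noteq> 0" for U
    using that LamD[OF fg(1), of U] LamD[OF fg(2), of U] by (cases "f U = 0") auto
  then show "f + g \<in> Lam n" by (simp add: Lam_def)
qed (auto simp: Lam_def sc_def)

lemma Lam_emul [simp]:
  assumes "f \<in> Lam n" "g \<in> Lam n"
  shows "emul f g \<in> Lam n"
  unfolding Lam_def
proof safe
  fix U u assume "emul f g U \<noteq> 0" "u \<in> U"
  then obtain S where S: "S \<in> Pow U" "esign S (U - S) * f S * g (U - S) \<noteq> 0"
    unfolding emul_def by (meson sum.neutral)
  then have "S \<subseteq> Gens n" "U - S \<subseteq> Gens n" using assms LamD by (metis mult_eq_0_iff)+
  with \<open>u \<in> U\<close> show "u \<in> Gens n" by auto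
qed

lemma Lam_egen: "egen g \<in> Lam n \<longleftrightarrow> g \<in> Gens n"
  by (auto simp: Lam_def egen_def)

lemma Lam_mono: "mono U \<in> Lam n \<longleftrightarrow> U \<subseteq> Gens n"
  by (auto simp: Lam_def mono_def)

lemma Lam_eone [simp]: "eone \<in> Lam n"
  by (auto simp: Lam_def eone_def)

lemma Lam_0 [simp]: "0 \<in> Lam n" using ev.subspace_0[OF subspace_Lam] .
lemma Lam_add [simp]: "f \<in> Lam n \<Longrightarrow> g \<in> Lam n \<Longrightarrow> f + g \<in> Lam n" 
  using ev.subspace_add[OF subspace_Lam] .
lemma Lam_diff [simp]: "f \<in> Lam n \<Longrightarrow> g \<in> Lam n \<Longrightarrow> f - g \<in> Lam n"
  using ev.subspace_diff[OF subspace_Lam] .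

lemma sum_elt_apply: "(\<Sum>i\<in>I. f i) (U :: gen set) = (\<Sum>i\<in>I. f i U :: rat)"
  by (induction I rule: infinite_finite_induct) auto

lemma Lam_mono_expansion:
  assumes "f \<in> Lam n"
  shows "f = (\<Sum>U\<in>Pow (Gens n). sc (f U) (mono U))"
proof
  fix V
  have "(\<Sum>U\<in>Pow (Gens n). sc (f U) (mono U)) V = (\<Sum>U\<in>Pow (Gens n). if U = V then f U else 0)"
    unfolding sum_elt_apply by (rule sum.cong) (auto simp: sc_def mono_def)
  also have "\<dots> = f V" using assms LamD by (auto simp: sum.delta)
  finally show "f V = (\<Sum>U\<in>Pow (Gens n). sc (f U) (mono U)) V" by simp
qed

lemma emul_eone_right:
  assumes "f \<in> Lam n"
  shows "emul f eone = f"
proof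
  fix U
  show "emul f eone U = f U"
  proof (cases "finite U")
    case True
    have "emul f eone U = (\<Sum>S\<in>Pow U. if S = U then f U else 0)"
      unfolding emul_def
    proof (rule sum.cong)
      fix S assume "S \<in> Pow U"
      then show "esign S (U - S) * f S * eone (U - S) = (if S = U then f U else 0)"
        by (cases "S = U") (auto simp: eone_def esign_empty_right)
    qed simp
    then show ?thesis using True by simp
  next
    case False
    then show ?thesis using LamD_finite[OF assms] by (auto simp: emul_infinite)
  qed
qed

text \<open>Contraction by \<open>w\<close>, that is, the left derivative with respect to this
  generator. It lets \<open>d2\<close> be written as the sum of \<open>dgen w\<close> times the
  contraction by \<open>w\<close>, so that the Leibniz rule for \<open>d2\<close> is inherited from
  the antiderivation rule for contractions.\<close>

definition contr :: "gen \<Rightarrow> elt \<Rightarrow> elt" where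
  "contr w f = (\<lambda>U. if w \<notin> U \<and> finite U then (-1) ^ card {u\<in>U. rank u < rank w} * f (insert w U) else 0)"

lemma card_insert_filter:
  assumes "finite U" "w \<notin> U"
  shows "card {u\<in>insert w U. P u} = card {u\<in>U. P u} + (if P w then 1 else 0)"
proof -
  have "{u\<in>insert w U. P u} = (if P w then insert w {u\<in>U. P u} else {u\<in>U. P u})" by auto
  then show ?thesis using assms by auto
qed

lemma contr_egen:
  assumes "f \<in> Lam n"
  shows "contr w (emul (egen g) f) = (if g = w then f else 0) - emul (egen g) (contr w f)"
proof
  fix U
  show "contr w (emul (egen g) f) U = ((if g = w then f else 0) - emul (egen g) (contr w f)) U"
  proof (cases "finite U")
    case False
    then show ?thesis using LamD_finite[OF assms]
      by (auto simp: contr_def emul_infinite)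
  next
    case fin: True
    show ?thesis
    proof (cases "g = w")
      case True
      have "(-1) ^ card {u\<in>U. rank u < rank w} * ((-1) ^ card {u\<in>U - {w}. rank u < rank w} * f (insert w (U - {w}))) = f U"
        if "w \<in> U"
      proof -
        have "{u\<in>U - {w}. rank u < rank w} = {u\<in>U. rank u < rank w}" by auto
        then show ?thesis using that by (simp add: insert_absorb flip: mult.assoc power_add)
      qed
      moreover have "{u \<in> insert w U. rank u < rank w} = {u\<in>U. rank u < rank w}" by auto
      ultimately show ?thesis using fin True
        by (auto simp: contr_def emul_egen_left insert_absorb simp flip: mult.assoc power_add)
    next
      case False
      show ?thesis
      proof (cases "g \<in> U \<and> w \<notin> U")
        case gw: True
        define V where "V = U - {g}"
        have V: "U = insert g V" "g \<notin> V" "w \<notin> V" "finite V" using gw fin by (auto simp: V_def)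
        have eq: "insert w (insert g V) - {g} = insert w V" using V False by auto
        have ne: "rank g \<noteq> rank w" using False by simp
        have w: "w \<notin> insert g V" and gi: "g \<in> insert w (insert g V)" "g \<in> insert g V"
          and g: "insert g V - {g} = V" using V False by auto
        have "contr w (emul (egen g) f) (insert g V) = (-1) ^ card {u\<in>insert g V. rank u < rank w}
            * ((-1) ^ card {u\<in>insert w (insert g V). rank u < rank g} * f (insert w V))"
          using w gi V(4) by (simp only: contr_def emul_egen_left eq finite_insert if_True not_False_eq_True simp_thms)
        \<comment> \<open>Exactly one of \<open>g\<close> and \<open>w\<close> has the smaller rank,
          so exactly one of the two exponents counts one element more than on the other side. This
          is the minus sign.\<close>
        also have "\<dots> = - ((-1) ^ card {u\<in>insert g V. rank u < rank g} * ((-1) ^ card {u\<in>V. rank u < rank w} * f (insert w V)))"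
          unfolding card_insert_filter[OF finite.insertI[OF V(4)] w] card_insert_filter[OF V(4) V(2)]
          using ne by (simp add: power_add)
        also have "\<dots> = - emul (egen g) (contr w f) (insert g V)"
          using V(2-4) by (simp only: contr_def emul_egen_left gi g finite_insert if_True not_False_eq_True simp_thms)
        finally have "contr w (emul (egen g) f) U = - emul (egen g) (contr w f) U" by (simp only: V(1)[symmetric])
        then show ?thesis using \<open>g \<noteq> w\<close> by simp
      next
        case False
        then show ?thesis using \<open>g \<noteq> w\<close> fin by (auto simp: contr_def emul_egen_left)
      qed
    qed
  qed
qed

lemma contr_mono_expansion:
  assumes "f \<in> Lam n"
  shows "contr w f = (\<Sum>U\<in>Pow (Gens n).
    if w \<in> U then sc (f U * (-1) ^ card {u\<in>U. rank u < rank w}) (mono (U - {w})) else 0)"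
proof
  fix V
  have "(\<Sum>U\<in>Pow (Gens n).
    if w \<in> U then sc (f U * (-1) ^ card {u\<in>U. rank u < rank w}) (mono (U - {w})) else 0) V
   = (\<Sum>U\<in>Pow (Gens n). if U = insert w V then contr w f V else 0)"
    unfolding sum_elt_apply
  proof (rule sum.cong)
    fix U assume U: "U \<in> Pow (Gens n)"
    then have fin: "finite U" using finite_subset finite_Gens by blast
    show "(if w \<in> U then sc (f U * (-1) ^ card {u\<in>U. rank u < rank w}) (mono (U - {w})) else 0) V
       = (if U = insert w V then contr w f V else 0)"
    proof (cases "w \<in> U \<and> V = U - {w}")
      case True
      then have "insert w V = U" "w \<notin> V" "finite V" using fin by auto
      moreover from this have "{u\<in>U. rank u < rank w} = {u\<in>V. rank u < rank w}" by auto
      ultimately show ?thesis using True by (auto simp: sc_def mono_def contr_def)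
    next
      case False
      then have "contr w f V = 0" if "U = insert w V"
        using that by (auto simp: contr_def)
      with False show ?thesis by (auto simp: sc_def mono_def)
    qed
  qed simp
  also have "\<dots> = (if insert w V \<subseteq> Gens n then contr w f V else 0)"
    by (simp add: sum.delta)
  also have "\<dots> = contr w f V"
    using LamD[OF assms, of "insert w V"] by (auto simp: contr_def)
  finally show "contr w f V = (\<Sum>U\<in>Pow (Gens n).
    if w \<in> U then sc (f U * (-1) ^ card {u\<in>U. rank u < rank w}) (mono (U - {w})) else 0) V" by simp
qed

lemma d2_contr:
  assumes "f \<in> Lam n"
  shows "d2 n f = (\<Sum>w\<in>{w\<in>Gens n. isW w}. emul (dgen w) (contr w f))"
proof -
  have "d2 n f = (\<Sum>U\<in>Pow (Gens n). \<Sum>w\<in>{w\<in>Gens n. isW w}. emul (dgen w)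
     (if w \<in> U then sc (f U * (-1) ^ card {u\<in>U. rank u < rank w}) (mono (U - {w})) else 0))"
    unfolding d2_def
  proof (rule sum.cong)
    fix U assume U: "U \<in> Pow (Gens n)"
    then have eq: "{w\<in>U. isW w} = {w\<in>{w\<in>Gens n. isW w}. w \<in> U}" by auto
    have "sc (f U) (dmono U) = (\<Sum>w\<in>{w\<in>U. isW w}. emul (dgen w)
      (sc (f U * (-1) ^ card {u\<in>U. rank u < rank w}) (mono (U - {w}))))"
      by (simp add: dmono_def ev.scale_sum_right emul_sc_right)
    also have "\<dots> = (\<Sum>w\<in>{w\<in>Gens n. isW w}. if w \<in> U then emul (dgen w)
      (sc (f U * (-1) ^ card {u\<in>U. rank u < rank w}) (mono (U - {w}))) else 0)"
      unfolding eq by (subst sum.inter_filter) auto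
    also have "\<dots> = (\<Sum>w\<in>{w\<in>Gens n. isW w}. emul (dgen w)
     (if w \<in> U then sc (f U * (-1) ^ card {u\<in>U. rank u < rank w}) (mono (U - {w})) else 0))"
      by (rule sum.cong) auto
    finally show "sc (f U) (dmono U) = \<dots>" .
  qed simp
  also have "\<dots> = (\<Sum>w\<in>{w\<in>Gens n. isW w}. emul (dgen w) (contr w f))"
    by (subst sum.swap) (simp only: contr_mono_expansion[OF assms] emul_sum_right)
  finally show ?thesis .
qed

lemma deg1_xg [simp]: "deg1 (xg i)" and deg1_yg [simp]: "deg1 (yg i)" and deg1_wg [simp]: "deg1 (wg i j)"
  by (simp_all add: xg_def yg_def wg_def)

text \<open>\<open>dgen w\<close> is zero or a product of two elements of degree one, so the two
  sign changes cancel.\<close>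

lemma dgen_left_commute:
  assumes "deg1 f"
  shows "emul (dgen w) (emul f h) = emul f (emul (dgen w) h)"
proof (cases w)
  case (W i j)
  define a b where "a = xg i - xg j" and "b = yg i - yg j"
  have ab: "deg1 a" "deg1 b" by (simp_all add: a_def b_def)
  have "dgen w = emul a b" by (simp add: dgen_def W a_def b_def)
  then show ?thesis
    using deg1_left_commute[OF ab(1) assms] deg1_left_commute[OF ab(2) assms]
    by (simp add: emul_assoc emul_minus_right)
qed (simp_all add: dgen_def)

text \<open>Leibniz rule for one generator on the left. Longer products are differentiated by
  peeling off one factor at a time with it.\<close>

lemma d2_egen:
  assumes "f \<in> Lam n" "g \<in> Gens n"
  shows "d2 n (emul (egen g) f) = emul (dgen g) f - emul (egen g) (d2 n f)"
proof -
  have "emul (egen g) f \<in> Lam n" using assms by (simp add: Lam_egen)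
  then have "d2 n (emul (egen g) f) = (\<Sum>w\<in>{w\<in>Gens n. isW w}. emul (dgen w) (if g = w then f else 0))
     - (\<Sum>w\<in>{w\<in>Gens n. isW w}. emul (dgen w) (emul (egen g) (contr w f)))"
    by (simp add: d2_contr contr_egen[OF assms(1)] emul_diff_right sum_subtractf)
  also have "(\<Sum>w\<in>{w\<in>Gens n. isW w}. emul (dgen w) (if g = w then f else 0))
     = (\<Sum>w\<in>{w\<in>Gens n. isW w}. if w = g then emul (dgen w) f else 0)"
    by (rule sum.cong) auto
  also have "\<dots> = emul (dgen g) f"
  proof (cases "isW g")
    case False
    then have "dgen g = 0" by (cases g) (auto simp: dgen_def)
    then show ?thesis by (simp add: sum.delta)
  qed (simp add: sum.delta assms)
  also have "(\<Sum>w\<in>{w\<in>Gens n. isW w}. emul (dgen w) (emul (egen g) (contr w f))) = emul (egen g) (d2 n f)"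
    by (simp only: dgen_left_commute[OF deg1_egen] d2_contr[OF assms(1)] emul_sum_right)
  finally show ?thesis .
qed

lemma d2_add: "d2 n (f + g) = d2 n f + d2 n g"
  by (simp add: d2_def ev.scale_left_distrib sum.distrib)
lemma d2_sc: "d2 n (sc c f) = sc c (d2 n f)"
proof -
  have "sc c f U = c * f U" for U by (simp add: sc_def)
  then show ?thesis by (simp add: d2_def ev.scale_sum_right)
qed
lemma d2_0 [simp]: "d2 n 0 = 0"
  by (simp add: d2_def)
lemma d2_diff: "d2 n (f - g) = d2 n f - d2 n g"
  by (simp add: d2_def ev.scale_left_diff_distrib sum_subtractf)
lemma d2_sum: "d2 n (\<Sum>i\<in>I. f i) = (\<Sum>i\<in>I. d2 n (f i))"
  by (induction I rule: infinite_finite_induct)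
    (simp_all only: sum.infinite sum.empty sum.insert d2_add d2_0 not_False_eq_True)

subsection \<open>The ideal of relations\<close>

lemma emul_eone_left:
  assumes "f \<in> Lam n"
  shows "emul eone f = f"
proof
  fix U
  show "emul eone f U = f U"
  proof (cases "finite U")
    case True
    have "emul eone f U = (\<Sum>S\<in>Pow U. if S = {} then f U else 0)"
      unfolding emul_def by (rule sum.cong) (auto simp: eone_def esign_def)
    then show ?thesis using True by simp
  next
    case False
    then show ?thesis using LamD_finite[OF assms] by (auto simp: emul_infinite)
  qed
qed

lemma mono_insert:
  assumes "finite U" "g \<notin> U"
  shows "mono (insert g U) = sc ((-1) ^ card {u\<in>U. rank u < rank g}) (emul (egen g) (mono U))"
proof
  fix V
  show "mono (insert g U) V = sc ((-1) ^ card {u\<in>U. rank u < rank g}) (emul (egen g) (mono U)) V"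
  proof (cases "V = insert g U")
    case True
    have "{u\<in>insert g U. rank u < rank g} = {u\<in>U. rank u < rank g}" by auto
    moreover have "insert g U - {g} = U" using assms by auto
    ultimately show ?thesis using True assms
      by (simp only: sc_def mono_def emul_egen_left finite_insert insertI1 if_True flip: mult.assoc power_add)
        simp
  next
    case False
    have "emul (egen g) (mono U) V = 0"
    proof (cases "finite V")
      case True
      have "mono U (V - {g}) = 0" if "g \<in> V" using False that by (auto simp: mono_def)
      then show ?thesis using True by (simp only: emul_egen_left) simp
    qed (simp add: emul_infinite)
    then show ?thesis using False by (simp add: sc_def mono_def)
  qed
qed

lemma mono_empty: "mono {} = eone"
  by (simp add: mono_def eone_def)

text \<open>Monomials arise from \<open>eone\<close> by left multiplication with generators, the
  very shape to which \<open>d2_egen\<close> applies.\<close>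

lemma Lam_induct [consumes 1, case_names eone egen zero add sc]:
  assumes "f \<in> Lam n"
    and "P eone"
    and "\<And>g f. g \<in> Gens n \<Longrightarrow> f \<in> Lam n \<Longrightarrow> P f \<Longrightarrow> P (emul (egen g) f)"
    and "P 0"
    and "\<And>f g. P f \<Longrightarrow> P g \<Longrightarrow> P (f + g)"
    and "\<And>c f. P f \<Longrightarrow> P (sc c f)"
  shows "P f"
proof -
  have mono: "P (mono U)" if "U \<subseteq> Gens n" for U
  proof -
    have "finite U" using that finite_subset finite_Gens by blast
    then show ?thesis using that
    proof (induction U)
      case (insert g U)
      have "P (emul (egen g) (mono U))"
        using insert by (intro assms(3)) (simp_all add: Lam_mono)
      then show ?case using insert.hyps assms(6) by (simp add: mono_insert)
    qed (simp add: mono_empty assms(2))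
  qed
  have "P (\<Sum>U\<in>A. sc (f U) (mono U))" if "A \<subseteq> Pow (Gens n)" for A
  proof -
    have "finite A" using that finite_subset finite_Pow_iff finite_Gens by metis
    then show ?thesis using that
    proof (induction A)
      case empty
      show ?case unfolding sum.empty by (rule assms(4))
    next
      case (insert U A)
      then have "P (sc (f U) (mono U))" by (intro assms(6)[OF mono]) auto
      moreover have "P (\<Sum>U\<in>A. sc (f U) (mono U))" using insert by simp
      ultimately show ?case unfolding sum.insert[OF insert.hyps] by (rule assms(5))
    qed
  qed
  then show ?thesis using Lam_mono_expansion[OF assms(1)] by (metis order_refl)
qed

text \<open>An even element is central. As \<open>h\<close> may be inhomogeneous, it is built up
  generator by generator, each exchange costing two signs.\<close>

lemma deg1_pair_commute:
  assumes "deg1 a" "deg1 b" "h \<in> Lam n" "a \<in> Lam n" "b \<in> Lam n"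
  shows "emul (emul a b) h = emul h (emul a b)"
  using assms(3)
proof (induction h rule: Lam_induct)
  case eone
  then show ?case using assms by (simp add: emul_eone_right[where n = n] emul_eone_left[where n = n])
next
  case (egen g f)
  have "emul (emul a b) (emul (egen g) f) = emul (egen g) (emul (emul a b) f)"
    unfolding emul_assoc deg1_left_commute[OF assms(2) deg1_egen] emul_minus_right
      deg1_left_commute[OF assms(1) deg1_egen] minus_minus ..
  then show ?case using egen by (simp add: emul_assoc)
qed (simp_all del: plus_fun_apply zero_fun_apply add: emul_linear)

lemma X_Gens [simp]: "X i \<in> Gens n \<longleftrightarrow> i \<in> {1..n}" and Y_Gens [simp]: "Y i \<in> Gens n \<longleftrightarrow> i \<in> {1..n}"
  and W_Gens [simp]: "W i j \<in> Gens n \<longleftrightarrow> 1 \<le> i \<and> i < j \<and> j \<le> n"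
  by (auto simp: Gens_def)

lemma Lam_xg [simp]: "i \<in> {1..n} \<Longrightarrow> xg i \<in> Lam n"
  and Lam_yg [simp]: "i \<in> {1..n} \<Longrightarrow> yg i \<in> Lam n"
  by (auto simp: xg_def yg_def Lam_egen)

lemma Lam_wg [simp]: "i \<in> {1..n} \<Longrightarrow> j \<in> {1..n} \<Longrightarrow> i \<noteq> j \<Longrightarrow> wg i j \<in> Lam n"
  by (auto simp: wg_def Lam_egen)

lemma subspace_Ideal: "ev.subspace (Ideal n)"
  by (simp add: Ideal_def)

lemma Ideal_0 [simp]: "0 \<in> Ideal n" using ev.subspace_0[OF subspace_Ideal] .
lemma Ideal_add: "f \<in> Ideal n \<Longrightarrow> g \<in> Ideal n \<Longrightarrow> f + g \<in> Ideal n" 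
  using ev.subspace_add[OF subspace_Ideal] .
lemma Ideal_diff: "f \<in> Ideal n \<Longrightarrow> g \<in> Ideal n \<Longrightarrow> f - g \<in> Ideal n"
  using ev.subspace_diff[OF subspace_Ideal] .
lemma Ideal_neg: "f \<in> Ideal n \<Longrightarrow> - f \<in> Ideal n"
  using ev.subspace_neg[OF subspace_Ideal] .
lemma Ideal_sc: "f \<in> Ideal n \<Longrightarrow> sc c f \<in> Ideal n"
  using ev.subspace_scale[OF subspace_Ideal] .
lemma Ideal_sum: "(\<And>i. i \<in> I \<Longrightarrow> f i \<in> Ideal n) \<Longrightarrow> (\<Sum>i\<in>I. f i) \<in> Ideal n"
  using ev.subspace_sum[OF subspace_Ideal] .

lemma Ideal_induct [consumes 1, case_names base zero add sc]:
  assumes "f \<in> Ideal n"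
    and base: "\<And>a r. a \<in> Lam n \<Longrightarrow> r \<in> rels n \<Longrightarrow> P (emul a r)"
    and "P 0"
    and "\<And>f g. P f \<Longrightarrow> P g \<Longrightarrow> P (f + g)"
    and "\<And>c f. P f \<Longrightarrow> P (sc c f)"
  shows "P f"
  using assms(1) unfolding Ideal_def
proof (induction rule: ev.span_induct_alt)
  case (step c x y)
  then have "P x" using base by auto
  show ?case by (rule assms(4)[OF assms(5)[OF \<open>P x\<close>] step(2)])
qed (rule assms(3))

lemma Ideal_left:
  assumes "a \<in> Lam n" "f \<in> Ideal n"
  shows "emul a f \<in> Ideal n"
  using assms(2)
proof (induction rule: Ideal_induct)
  case (base b r)
  then have "emul (emul a b) r \<in> Ideal n"
    unfolding Ideal_def using assms(1) by (intro ev.span_base) (auto intro: Lam_emul)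
  then show ?case by (simp add: emul_assoc)
qed (simp_all del: plus_fun_apply zero_fun_apply add: emul_linear Ideal_add Ideal_sc)

lemma rels_Lam: "r \<in> rels n \<Longrightarrow> r \<in> Lam n"
  by (auto simp: rels_def)

lemma rels_Ideal: "r \<in> rels n \<Longrightarrow> r \<in> Ideal n"
  unfolding Ideal_def
  by (rule ev.span_base) (metis (mono_tags, lifting) Lam_eone emul_eone_left mem_Collect_eq rels_Lam)

text \<open>A parameter for the two families of generators of bidegree (1,0), so that
  \<open>L_C\<close> and \<open>L'_C\<close> are treated by one argument.\<close>

definition letter :: "(nat \<Rightarrow> gen) \<Rightarrow> bool" where
  "letter v \<longleftrightarrow> v = X \<or> v = Y"

lemma letter_Gens [simp]: "letter v \<Longrightarrow> v i \<in> Gens n \<longleftrightarrow> i \<in> {1..n}"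
  by (auto simp: letter_def)

lemma letter_Lam [simp]: "letter v \<Longrightarrow> i \<in> {1..n} \<Longrightarrow> egen (v i) \<in> Lam n"
  by (simp add: Lam_egen)

text \<open>The ideal is spanned by left multiples of relations; the relation here is a product of
  two degree-one elements, so a factor \<open>h\<close> on its right can be moved to the
  left.\<close>

lemma Ideal_letter:
  assumes "letter v" "i \<in> {1..n}" "j \<in> {1..n}" "i \<noteq> j" "h \<in> Lam n"
  shows "emul (egen (v i) - egen (v j)) (emul (wg i j) h) \<in> Ideal n"
proof -
  have "emul (egen (v i) - egen (v j)) (wg i j) \<in> rels n"
    using assms unfolding letter_def rels_def xg_def yg_def by blast
  then have "emul h (emul (egen (v i) - egen (v j)) (wg i j)) \<in> Ideal n"
    by (intro Ideal_left rels_Ideal assms)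
  moreover have "emul (emul (egen (v i) - egen (v j)) (wg i j)) h = emul h (emul (egen (v i) - egen (v j)) (wg i j))"
    using assms by (intro deg1_pair_commute[where n = n]) simp_all
  ultimately show ?thesis by (simp add: emul_assoc)
qed

lemma wg_commute: "wg i j = wg j i"
  by (simp add: wg_def min.commute max.commute)

definition egW :: "nat \<Rightarrow> nat \<Rightarrow> gen" where "egW i j = W (min i j) (max i j)"

lemma egW_Gens: "i \<in> {1..n} \<Longrightarrow> j \<in> {1..n} \<Longrightarrow> i \<noteq> j \<Longrightarrow> egW i j \<in> Gens n"
  by (auto simp: egW_def)

lemma wg_egW: "wg i j = egen (egW i j)"
  by (simp add: wg_def egW_def)

lemma dgen_egW: "dgen (egW i j) = emul (xg i - xg j) (yg i - yg j)"
proof (cases "i \<le> j")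
  case False
  have "emul (xg j - xg i) (yg j - yg i) = emul (xg i - xg j) (yg i - yg j)"
    by (simp add: emul_diff_left emul_diff_right)
  then show ?thesis using False by (simp add: dgen_def egW_def)
qed (simp add: dgen_def egW_def)

lemma dgen_Lam: "g \<in> Gens n \<Longrightarrow> dgen g \<in> Lam n"
  by (cases g) (auto simp: dgen_def)

lemma d2_wg:
  assumes "f \<in> Lam n" "i \<in> {1..n}" "j \<in> {1..n}" "i \<noteq> j"
  shows "d2 n (emul (wg i j) f) = emul (xg i - xg j) (emul (yg i - yg j) f) - emul (wg i j) (d2 n f)"
  using d2_egen[OF assms(1) egW_Gens[OF assms(2-4)]] by (simp add: wg_egW dgen_egW emul_assoc)

lemma d2_eone [simp]: "d2 n eone = 0"
proof -
  have "contr w eone = 0" for w by (auto simp: contr_def eone_def)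
  then show ?thesis by (simp add: d2_contr)
qed

lemma d2_wg_single:
  assumes "i \<in> {1..n}" "j \<in> {1..n}" "i \<noteq> j"
  shows "d2 n (wg i j) = emul (xg i - xg j) (yg i - yg j)"
  using d2_wg[OF Lam_eone assms] assms
  by (simp add: emul_eone_right[where n = n])

lemma d2_letter:
  assumes "letter v" "f \<in> Lam n" "i \<in> {1..n}"
  shows "d2 n (emul (egen (v i)) f) = - emul (egen (v i)) (d2 n f)"
proof -
  have "dgen (v i) = 0" using assms by (auto simp: letter_def dgen_def)
  then show ?thesis using d2_egen[OF assms(2), of "v i"] assms by simp
qed

lemma d2_letter_diff:
  assumes "letter v" "f \<in> Lam n" "i \<in> {1..n}" "j \<in> {1..n}"
  shows "d2 n (emul (egen (v i) - egen (v j)) f) = - emul (egen (v i) - egen (v j)) (d2 n f)"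
  using assms by (simp add: emul_diff_left d2_diff d2_letter)

text \<open>Modulo the ideal, \<open>wg j k\<close> identifies the letters at \<open>j\<close> and
  \<open>k\<close>, hence also the differentials of the edges joining \<open>i\<close> to them.
  Exchanging first the x-factor and then the y-factor gives the two explicit multiples of
  relations.\<close>

lemma arnold_aux:
  assumes "i \<in> {1..n}" "j \<in> {1..n}" "k \<in> {1..n}" "j \<noteq> k"
  shows "emul (emul (xg i - xg j) (yg i - yg j)) (wg j k)
       - emul (emul (xg k - xg i) (yg k - yg i)) (wg j k) \<in> Ideal n"
proof -
  have k: "emul (xg j - xg k) (wg j k) \<in> Ideal n" "emul (yg j - yg k) (wg j k) \<in> Ideal n"
    by (rule rels_Ideal; use assms in \<open>unfold rels_def, blast\<close>)+
  let ?w = "wg j k"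
  have "emul (emul (xg i - xg j) (yg i - yg j)) ?w - emul (emul (xg k - xg i) (yg k - yg i)) ?w
     = emul (yg i - yg j) (emul (xg j - xg k) ?w) - emul (xg i - xg k) (emul (yg j - yg k) ?w)"
    by (simp add: emul_assoc emul_linear deg1_left_commute[of "yg _" "xg _"] algebra_simps)
  also have "\<dots> \<in> Ideal n"
    using assms by (intro Ideal_diff Ideal_left k) simp_all
  finally show ?thesis .
qed

lemma d2_rels:
  assumes "r \<in> rels n"
  shows "d2 n r \<in> Ideal n"
proof -
  consider (x) i j where "r = emul (egen (X i) - egen (X j)) (wg i j)" "i \<in> {1..n}" "j \<in> {1..n}" "i \<noteq> j"
    | (y) i j where "r = emul (egen (Y i) - egen (Y j)) (wg i j)" "i \<in> {1..n}" "j \<in> {1..n}" "i \<noteq> j"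
    | (a) i j k where "r = emul (wg i j) (wg j k) + emul (wg j k) (wg k i) + emul (wg k i) (wg i j)"
       "i \<in> {1..n}" "j \<in> {1..n}" "k \<in> {1..n}" "i \<noteq> j" "j \<noteq> k" "i \<noteq> k"
    using assms unfolding rels_def xg_def yg_def by blast
  then show ?thesis
  proof cases
    case x
    then have "d2 n r = - emul (xg i - xg j) (emul (xg i - xg j) (yg i - yg j))"
      by (simp add: d2_letter_diff[of X] letter_def d2_wg_single xg_def)
    then show ?thesis by (simp add: deg1_square_left)
  next
    case y
    then have "d2 n r = - emul (yg i - yg j) (emul (xg i - xg j) (yg i - yg j))"
      by (simp add: d2_letter_diff[of Y] letter_def d2_wg_single yg_def)
    also have "\<dots> = emul (xg i - xg j) (emul (yg i - yg j) (yg i - yg j))"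
      by (subst deg1_left_commute) simp_all
    finally show ?thesis by (simp add: deg1_square)
  next
    case a
    define D where "D i j = emul (xg i - xg j) (yg i - yg j)" for i j
    have dd: "d2 n (emul (wg i j) (wg k l)) = emul (D i j) (wg k l) - emul (D k l) (wg i j)"
      if "i \<in> {1..n}" "j \<in> {1..n}" "k \<in> {1..n}" "l \<in> {1..n}" "i \<noteq> j" "k \<noteq> l" for i j k l
    proof -
      have "emul (wg i j) (D k l) = emul (D k l) (wg i j)"
        unfolding D_def using that by (intro deg1_pair_commute[symmetric, where n = n]) simp_all
      then show ?thesis using that by (simp add: d2_wg d2_wg_single D_def emul_assoc)
    qed
    \<comment> \<open>The six terms are grouped by the edge generator that remains; each group is an
      instance of \<open>arnold_aux\<close>.\<close>
    have "d2 n r = (emul (D i j) (wg j k) - emul (D k i) (wg j k))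
       + (emul (D j k) (wg k i) - emul (D i j) (wg k i)) + (emul (D k i) (wg i j) - emul (D j k) (wg i j))"
      using a by (simp add: d2_add dd)
    also have "\<dots> \<in> Ideal n"
      unfolding D_def using a by (intro Ideal_add arnold_aux) simp_all
    finally show ?thesis .
  qed
qed

text \<open>This is what makes \<open>d2\<close> well defined on the quotient; in the dimension
  count it places the elements of the ideal among the cocycles.\<close>

lemma d2_Ideal:
  assumes "f \<in> Ideal n"
  shows "d2 n f \<in> Ideal n"
  using assms
proof (induction rule: Ideal_induct)
  case (base a r)
  from base(1) show ?case
  proof (induction rule: Lam_induct)
    case eone
    then show ?case using base by (simp add: emul_eone_left[where n = n] rels_Lam d2_rels)
  next
    case (egen g f)
    have "d2 n (emul (emul (egen g) f) r) = emul (dgen g) (emul f r) - emul (egen g) (d2 n (emul f r))"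
      using egen base by (simp add: emul_assoc d2_egen rels_Lam)
    also have "\<dots> \<in> Ideal n"
      using egen base by (intro Ideal_diff Ideal_left) (simp_all add: dgen_Lam Lam_egen rels_Ideal)
    finally show ?case .
  qed (simp_all del: plus_fun_apply zero_fun_apply add: emul_linear d2_add d2_sc Ideal_add Ideal_sc)
qed (simp_all del: plus_fun_apply zero_fun_apply add: d2_add d2_sc Ideal_add Ideal_sc)

subsection \<open>The cycle elements are cocycles\<close>

definition cedge :: "nat list \<Rightarrow> nat \<Rightarrow> gen" where
  "cedge vs m = egW (csrc vs m) (ctgt vs m)"

definition edge_difference :: "(nat \<Rightarrow> gen) \<Rightarrow> nat list \<Rightarrow> nat \<Rightarrow> elt" where
  "edge_difference v vs m = egen (v (ctgt vs m)) - egen (v (csrc vs m))"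

definition cycle_elt :: "(nat \<Rightarrow> gen) \<Rightarrow> nat list \<Rightarrow> elt" where
  "cycle_elt v vs = (\<Sum>(i, j)\<in>{(i, j). i < j \<and> j < length vs}.
     sc ((-1) ^ (i + j)) (emul (edge_difference v vs i) (omega_minus vs i j)))"

lemma L_C_cycle_elt: "L_C = cycle_elt X" and L'_C_cycle_elt: "L'_C = cycle_elt Y"
  by (simp_all add: fun_eq_iff L_C_def L'_C_def cycle_elt_def edge_difference_def xg_def yg_def)

lemma omega_c_cedge: "omega_c vs = (\<lambda>m. egen (cedge vs m))"
  by (simp add: omega_c_def cedge_def wg_egW fun_eq_iff)

lemma circuit_verts:
  assumes "is_circuit n vs" "m < length vs"
  shows "csrc vs m \<in> {1..n}" "ctgt vs m \<in> {1..n}" "csrc vs m \<noteq> ctgt vs m"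
proof -
  from assms have len: "length vs \<ge> 3" and d: "distinct vs" and s: "set vs \<subseteq> {1..n}"
    by (auto simp: is_circuit_def)
  have m': "(m + 1) mod length vs < length vs" using len by (intro mod_less_divisor) linarith
  have "m \<noteq> (m + 1) mod length vs"
  proof
    assume a: "m = (m + 1) mod length vs"
    show False
    proof (cases "m + 1 = length vs")
      case True
      with a len show False by simp
    next
      case False
      with assms(2) a show False by simp
    qed
  qed
  then show "csrc vs m \<noteq> ctgt vs m"
    using d m' assms(2) by (simp add: csrc_def ctgt_def nth_eq_iff_index_eq)
  show "csrc vs m \<in> {1..n}" "ctgt vs m \<in> {1..n}"
    using s m' assms(2) nth_mem unfolding csrc_def ctgt_def by blast+
qed

lemma cedge_Gens: "is_circuit n vs \<Longrightarrow> m < length vs \<Longrightarrow> cedge vs m \<in> Gens n"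
  unfolding cedge_def by (intro egW_Gens circuit_verts)

lemma edge_difference_Lam: "letter v \<Longrightarrow> is_circuit n vs \<Longrightarrow> m < length vs \<Longrightarrow> edge_difference v vs m \<in> Lam n"
  unfolding edge_difference_def by (intro Lam_diff letter_Lam circuit_verts)

lemma deg1_edge_difference [simp]: "deg1 (edge_difference v vs m)"
  by (simp add: edge_difference_def)

text \<open>The targets are the sources shifted cyclically by one. Consequently the edge differences
  around a circuit telescope to 0.\<close>

lemma sum_ctgt: "(\<Sum>m<length vs. f (ctgt vs m)) = (\<Sum>m<length vs. f (csrc vs m))"
  for f :: "nat \<Rightarrow> 'a :: comm_monoid_add"
proof (cases "vs = []")
  case False
  have "(\<Sum>m<length vs. f (ctgt vs m)) = (\<Sum>m<length vs. f (rotate1 vs ! m))"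
    by (rule sum.cong) (auto simp: ctgt_def nth_rotate1)
  also have "\<dots> = (\<Sum>m<length (rotate1 vs). f (rotate1 vs ! m))" by simp
  also have "\<dots> = sum_list (map f (rotate1 vs))"
    by (simp only: sum_list_sum_nth atLeast0LessThan length_map) (auto intro!: sum.cong)
  also have "\<dots> = sum_list (map f vs)"
    using False by (cases vs) (simp_all add: add.commute)
  also have "\<dots> = (\<Sum>m<length vs. f (csrc vs m))"
    by (simp only: sum_list_sum_nth atLeast0LessThan length_map csrc_def) (auto intro!: sum.cong)
  finally show ?thesis .
qed simp

lemma sum_edge_difference: "(\<Sum>m<length vs. edge_difference v vs m) = 0"
  unfolding edge_difference_def sum_subtractf sum_ctgt[of "\<lambda>i. egen (v i)"] by simp

lemma eprod_Nil [simp]: "eprod [] = eone" and eprod_Cons [simp]: "eprod (f # fs) = emul f (eprod fs)"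
  by (simp_all add: eprod_def)

lemma eprod_Lam: "set fs \<subseteq> Lam n \<Longrightarrow> eprod fs \<in> Lam n"
  by (induction fs) auto

lemma eprod_cedge_Lam:
  "is_circuit n vs \<Longrightarrow> set ms \<subseteq> {..<length vs} \<Longrightarrow> eprod (map (omega_c vs) ms) \<in> Lam n"
  by (rule eprod_Lam) (auto simp: omega_c_cedge Lam_egen cedge_Gens)

text \<open>The linear factor is moved to the right, at the cost of signs, until it meets the
  generator of its own edge, where a defining relation applies.\<close>

lemma edge_difference_eprod_Ideal:
  assumes "letter v" "is_circuit n vs" "set ms \<subseteq> {..<length vs}" "m \<in> set ms"
  shows "emul (edge_difference v vs m) (eprod (map (omega_c vs) ms)) \<in> Ideal n"
  using assms(3,4)
proof (induction ms)
  case (Cons a ms)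
  have P: "eprod (map (omega_c vs) ms) \<in> Lam n"
    using Cons.prems by (intro eprod_cedge_Lam assms) auto
  show ?case
  proof (cases "a = m")
    case True
    have "emul (egen (v (ctgt vs m)) - egen (v (csrc vs m)))
        (emul (wg (ctgt vs m) (csrc vs m)) (eprod (map (omega_c vs) ms))) \<in> Ideal n"
      using Cons.prems True circuit_verts[OF assms(2), of m]
      by (intro Ideal_letter assms P) auto
    moreover have "omega_c vs m = wg (ctgt vs m) (csrc vs m)" by (simp add: omega_c_def wg_commute)
    ultimately show ?thesis unfolding True by (simp only: list.map eprod_Cons edge_difference_def)
  next
    case False
    then have "emul (edge_difference v vs m) (eprod (map (omega_c vs) ms)) \<in> Ideal n" using Cons by auto
    moreover have "omega_c vs a \<in> Lam n" 
      using Cons.prems by (auto simp: omega_c_cedge Lam_egen cedge_Gens[OF assms(2)])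
    ultimately have "- emul (omega_c vs a) (emul (edge_difference v vs m) (eprod (map (omega_c vs) ms))) \<in> Ideal n"
      by (metis Ideal_neg Ideal_left)
    moreover have "emul (edge_difference v vs m) (emul (omega_c vs a) (eprod (map (omega_c vs) ms)))
       = - emul (omega_c vs a) (emul (edge_difference v vs m) (eprod (map (omega_c vs) ms)))"
      by (rule deg1_left_commute) (simp_all add: omega_c_cedge)
    ultimately show ?thesis by (simp only: list.map eprod_Cons)
  qed
qed simp

text \<open>The indices are increasing, so the number of smaller indices is the number of factors to
  the left, which is the Leibniz exponent.\<close>

lemma d2_eprod:
  fixes e :: "nat \<Rightarrow> gen"
  assumes "sorted_wrt (<) ms" "\<And>m. m \<in> set ms \<Longrightarrow> e m \<in> Gens n"
  shows "d2 n (eprod (map (\<lambda>m. egen (e m)) ms)) = (\<Sum>l\<in>set ms. sc ((-1) ^ card {m\<in>set ms. m < l})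
     (emul (dgen (e l)) (eprod (map (\<lambda>m. egen (e m)) (filter (\<lambda>m. m \<noteq> l) ms)))))"
  using assms
proof (induction ms)
  case (Cons a ms)
  let ?E = "\<lambda>ms. eprod (map (\<lambda>m. egen (e m)) ms)"
  have P: "?E ms \<in> Lam n" by (rule eprod_Lam) (use Cons.prems in \<open>auto simp: Lam_egen\<close>)
  have a: "\<And>m. m \<in> set ms \<Longrightarrow> a < m" "a \<notin> set ms" using Cons.prems by auto
  have fa: "filter (\<lambda>m. m \<noteq> a) ms = ms" using a by (auto intro: filter_True)
  have c0: "card {m\<in>set (a # ms). m < a} = 0" using a(1) by (auto simp: card_eq_0_iff dest: less_asym)
  have c1: "card {m\<in>set (a # ms). m < l} = Suc (card {m\<in>set ms. m < l})" if "l \<in> set ms" for l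
  proof -
    have "{m\<in>set (a # ms). m < l} = insert a {m\<in>set ms. m < l}" using a that by auto
    then show ?thesis using a by simp
  qed
  have s1: "sc (- c) f = - sc c f" for c f by (simp add: sc_def fun_eq_iff)
  have "d2 n (?E (a # ms)) = emul (dgen (e a)) (?E ms) - emul (egen (e a)) (d2 n (?E ms))"
    using Cons.prems P by (simp add: d2_egen)
  also have "d2 n (?E ms) = (\<Sum>l\<in>set ms. sc ((-1) ^ card {m\<in>set ms. m < l})
     (emul (dgen (e l)) (?E (filter (\<lambda>m. m \<noteq> l) ms))))"
    using Cons by simp
  also have "emul (egen (e a)) \<dots> = (\<Sum>l\<in>set ms. sc ((-1) ^ card {m\<in>set ms. m < l})
     (emul (dgen (e l)) (emul (egen (e a)) (?E (filter (\<lambda>m. m \<noteq> l) ms)))))"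
    by (simp add: emul_sum_right emul_sc_right dgen_left_commute)
  also have "emul (dgen (e a)) (?E ms) - \<dots> = emul (dgen (e a)) (?E ms) + (- \<dots>)" by simp
  also have "- (\<Sum>l\<in>set ms. sc ((-1) ^ card {m\<in>set ms. m < l})
     (emul (dgen (e l)) (emul (egen (e a)) (?E (filter (\<lambda>m. m \<noteq> l) ms)))))
    = (\<Sum>l\<in>set ms. sc ((-1) ^ card {m\<in>set (a # ms). m < l})
     (emul (dgen (e l)) (?E (filter (\<lambda>m. m \<noteq> l) (a # ms)))))"
    unfolding sum_negf[symmetric]
  proof (rule sum.cong)
    fix l assume "l \<in> set ms"
    with a(2) have "filter (\<lambda>m. m \<noteq> l) (a # ms) = a # filter (\<lambda>m. m \<noteq> l) ms" by auto
    with c1[OF \<open>l \<in> set ms\<close>] show "- sc ((-1) ^ card {m\<in>set ms. m < l})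
     (emul (dgen (e l)) (emul (egen (e a)) (?E (filter (\<lambda>m. m \<noteq> l) ms))))
      = sc ((-1) ^ card {m\<in>set (a # ms). m < l}) (emul (dgen (e l)) (?E (filter (\<lambda>m. m \<noteq> l) (a # ms))))"
      by (simp only: list.map eprod_Cons power_Suc s1 mult_minus_left mult_1_left)
  qed simp
  finally have "d2 n (?E (a # ms)) = emul (dgen (e a)) (?E ms) + (\<Sum>l\<in>set ms. sc ((-1) ^ card {m\<in>set (a # ms). m < l})
     (emul (dgen (e l)) (?E (filter (\<lambda>m. m \<noteq> l) (a # ms)))))" .
  moreover have "sc ((-1) ^ card {m\<in>set (a # ms). m < a}) (emul (dgen (e a)) (?E (filter (\<lambda>m. m \<noteq> a) (a # ms))))
     = emul (dgen (e a)) (?E ms)"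
    unfolding c0 using fa by simp
  moreover have "(\<Sum>l\<in>set (a # ms). G l) = G a + (\<Sum>l\<in>set ms. G l)" for G :: "nat \<Rightarrow> elt"
    using a(2) by simp
  ultimately show ?case by (simp only:)
qed simp

text \<open>Modulo the ideal, \<open>N\<close> is annihilated by \<open>A p + A q + A r\<close> and \<open>B p + B q + B r\<close>; eliminating \<open>A r\<close> and
  \<open>B r\<close> makes all terms cancel.\<close>
lemma triple_Ideal:
  fixes p q r k :: nat
  assumes A: "\<And>m. m < k \<Longrightarrow> deg1 (A m) \<and> A m \<in> Lam n" and B: "\<And>m. m < k \<Longrightarrow> deg1 (B m) \<and> B m \<in> Lam n"
    and sA: "(\<Sum>m<k. A m) = 0" and sB: "(\<Sum>m<k. B m) = 0"
    and pqr: "p < q" "q < r" "r < k"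
    and N: "\<And>m. m < k \<Longrightarrow> m \<notin> {p, q, r} \<Longrightarrow> emul (A m) N \<in> Ideal n \<and> emul (B m) N \<in> Ideal n"
  shows "emul (A p) (emul (emul (A r) (B r)) N) - emul (A p) (emul (emul (A q) (B q)) N)
    + emul (A q) (emul (emul (A p) (B p)) N) \<in> Ideal n"
proof -
  have split: "(\<Sum>m<k. C m) = C p + C q + C r + (\<Sum>m\<in>{..<k} - {p, q, r}. C m)" for C :: "nat \<Rightarrow> elt"
  proof -
    have "(\<Sum>m<k. C m) = (\<Sum>m\<in>{p, q, r}. C m) + (\<Sum>m\<in>{..<k} - {p, q, r}. C m)"
      by (subst add.commute, rule sum.subset_diff) (use pqr in auto)
    then show ?thesis using pqr by (simp add: add.assoc)
  qed
  have u: "emul (C p + C q + C r) N \<in> Ideal n"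
    if "(\<Sum>m<k. C m) = 0" "\<And>m. m < k \<Longrightarrow> m \<notin> {p, q, r} \<Longrightarrow> emul (C m) N \<in> Ideal n" for C
  proof -
    have "C p + C q + C r = - (\<Sum>m\<in>{..<k} - {p, q, r}. C m)"
      using split[of C] that(1) by (simp add: eq_neg_iff_add_eq_0)
    moreover have "- (\<Sum>m\<in>{..<k} - {p, q, r}. emul (C m) N) \<in> Ideal n"
      using that(2) by (intro Ideal_neg Ideal_sum) auto
    ultimately show ?thesis by (simp add: emul_sum_left emul_minus_left)
  qed
  define a b c a' b' c' where abc: "a = A p" "b = A q" "c = A r" "a' = B p" "b' = B q" "c' = B r"
  have d: "deg1 a" "deg1 b" "deg1 c" "deg1 a'" "deg1 b'" "deg1 c'"
    and L: "a \<in> Lam n" "b \<in> Lam n" "c \<in> Lam n" "a' \<in> Lam n" "b' \<in> Lam n" "c' \<in> Lam n"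
    using A B pqr by (auto simp: abc)
  have I: "emul (a + b + c) N \<in> Ideal n" "emul (a' + b' + c') N \<in> Ideal n"
    unfolding abc by (rule u; use sA sB N in blast)+
  note dc = d(2)[THEN deg1_left_commute, OF d(1)] d(3)[THEN deg1_left_commute, OF d(1)] d(3)[THEN deg1_left_commute, OF d(2)]
    d(4)[THEN deg1_left_commute, OF d(1)] d(4)[THEN deg1_left_commute, OF d(2)] d(4)[THEN deg1_left_commute, OF d(3)]
    d(5)[THEN deg1_left_commute, OF d(1)] d(5)[THEN deg1_left_commute, OF d(2)] d(5)[THEN deg1_left_commute, OF d(3)]
    d[THEN deg1_square_left]
  have "emul a (emul (emul c c') N) - emul a (emul (emul b b') N) + emul b (emul (emul a a') N)
    = emul a (emul c (emul (a' + b' + c') N)) + emul a (emul (a' + b') (emul (a + b + c) N))"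
    by (simp add: emul_assoc emul_linear dc del: plus_fun_apply)
  also have "\<dots> \<in> Ideal n"
    using L by (intro Ideal_add Ideal_left I) simp_all
  finally show ?thesis by (simp add: abc)
qed

text \<open>The differential deletes a third edge \<open>l\<close> after the pair \<open>i\<close>,
  \<open>j\<close>. Every triple is reached in three ways, with \<open>l\<close> as its greatest,
  middle or least member.\<close>

lemma sum_pairs_compl_triples:
  fixes F :: "nat \<Rightarrow> nat \<Rightarrow> nat \<Rightarrow> 'a :: comm_monoid_add"
  shows "(\<Sum>(i, j)\<in>{(i, j). i < j \<and> j < k}. \<Sum>l\<in>{..<k} - {i, j}. F i j l)
    = (\<Sum>(p, q, r)\<in>{(p, q, r). p < q \<and> q < r \<and> r < k}. F p q r + F p r q + F q r p)"
proof -
  have fin2: "finite {(i, j). i < j \<and> j < k}"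
    by (rule finite_subset[of _ "{..<k} \<times> {..<k}"]) auto
  have fin3: "finite {(i::nat, j, l). P i j l \<and> i < k \<and> j < k \<and> l < k}" for P
    by (rule finite_subset[of _ "{..<k} \<times> {..<k} \<times> {..<k}"]) auto
  let ?T = "\<lambda>P. {(i, j, l). P i j l \<and> i < k \<and> j < k \<and> l < k}"
  have "(\<Sum>(i, j)\<in>{(i, j). i < j \<and> j < k}. \<Sum>l\<in>{..<k} - {i, j}. F i j l)
    = (\<Sum>x\<in>{(i, j). i < j \<and> j < k}. \<Sum>l\<in>{..<k} - {fst x, snd x}. F (fst x) (snd x) l)"
    by (rule sum.cong) auto
  also have "\<dots> = (\<Sum>(x, l)\<in>(SIGMA x:{(i, j). i < j \<and> j < k}. {..<k} - {fst x, snd x}). F (fst x) (snd x) l)"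
    by (rule sum.Sigma) (use fin2 in auto)
  also have "\<dots> = (\<Sum>(i, j, l)\<in>?T (\<lambda>i j l. i < j \<and> l \<noteq> i \<and> l \<noteq> j). F i j l)"
    by (rule sum.reindex_bij_witness[where i = "\<lambda>(i, j, l). ((i, j), l)" and j = "\<lambda>((i, j), l). (i, j, l)"]) auto
  also have "?T (\<lambda>i j l. i < j \<and> l \<noteq> i \<and> l \<noteq> j)
     = ?T (\<lambda>i j l. i < j \<and> j < l) \<union> (?T (\<lambda>i j l. i < l \<and> l < j) \<union> ?T (\<lambda>i j l. l < i \<and> i < j))" by auto
  also have "(\<Sum>(i, j, l)\<in>\<dots>. F i j l) = (\<Sum>(i, j, l)\<in>?T (\<lambda>i j l. i < j \<and> j < l). F i j l)
     + ((\<Sum>(i, j, l)\<in>?T (\<lambda>i j l. i < l \<and> l < j). F i j l) + (\<Sum>(i, j, l)\<in>?T (\<lambda>i j l. l < i \<and> i < j). F i j l))"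
  proof -
    have "(\<Sum>(i, j, l)\<in>?T (\<lambda>i j l. i < l \<and> l < j) \<union> ?T (\<lambda>i j l. l < i \<and> i < j). F i j l)
      = (\<Sum>(i, j, l)\<in>?T (\<lambda>i j l. i < l \<and> l < j). F i j l) + (\<Sum>(i, j, l)\<in>?T (\<lambda>i j l. l < i \<and> i < j). F i j l)"
      by (rule sum.union_disjoint[OF fin3 fin3]) auto
    then show ?thesis by (subst sum.union_disjoint[OF fin3 finite_UnI[OF fin3 fin3]]) auto
  qed
  also have "(\<Sum>(i, j, l)\<in>?T (\<lambda>i j l. i < l \<and> l < j). F i j l) = (\<Sum>(p, q, r)\<in>?T (\<lambda>i j l. i < j \<and> j < l). F p r q)"
    by (rule sum.reindex_bij_witness[where i = "\<lambda>(p, q, r). (p, r, q)" and j = "\<lambda>(p, q, r). (p, r, q)"]) auto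
  also have "(\<Sum>(i, j, l)\<in>?T (\<lambda>i j l. l < i \<and> i < j). F i j l) = (\<Sum>(p, q, r)\<in>?T (\<lambda>i j l. i < j \<and> j < l). F q r p)"
    by (rule sum.reindex_bij_witness[where i = "\<lambda>(p, q, r). (q, r, p)" and j = "\<lambda>(q, r, p). (p, q, r)"]) auto
  also have "?T (\<lambda>i j l. i < j \<and> j < l) = {(p, q, r). p < q \<and> q < r \<and> r < k}" by auto
  finally show ?thesis
    by (simp add: sum.distrib case_prod_unfold add.assoc)
qed

lemma dgen_cedge:
  shows "dgen (cedge vs m) = emul (edge_difference X vs m) (edge_difference Y vs m)"
proof -
  have "emul (xg i - xg j) (yg i - yg j) = emul (xg j - xg i) (yg j - yg i)" for i j
    by (simp add: emul_diff_left emul_diff_right)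
  then show ?thesis by (simp add: cedge_def dgen_egW edge_difference_def xg_def yg_def)
qed

lemma d2_edge_difference:
  assumes "letter v" "is_circuit n vs" "m < length vs" "f \<in> Lam n"
  shows "d2 n (emul (edge_difference v vs m) f) = - emul (edge_difference v vs m) (d2 n f)"
  unfolding edge_difference_def by (intro d2_letter_diff circuit_verts assms)

text \<open>Removing \<open>i\<close> and \<open>j\<close> lowers the position of \<open>l\<close>
  by the number of them below \<open>l\<close>. Only parity counts, so the truncated subtraction can
  be replaced by an addition.\<close>

lemma card_less_compl_pair:
  assumes "i \<noteq> j" "l \<noteq> i" "l \<noteq> j" "i < k" "j < k" "l < (k::nat)"
  shows "(- 1 :: rat) ^ card {m\<in>{..<k} - {i, j}. m < l}
    = (- 1) ^ (l + (if i < l then 1 else 0) + (if j < l then 1 else 0))"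
proof -
  have "{m\<in>{..<k} - {i, j}. m < l} = {..<l} - {m\<in>{i, j}. m < l}" using assms by auto
  then have "card {m\<in>{..<k} - {i, j}. m < l} = l - card {m\<in>{i, j}. m < l}"
    by (simp only: card_Diff_subset) (simp add: card_Diff_subset subset_iff)
  also have "card {m\<in>{i, j}. m < l} = (if i < l then 1 else 0) + (if j < l then 1 else 0)"
    using assms by (subst card_insert_filter) (auto simp: card_insert_filter[of "{}", simplified])
  finally have c: "card {m\<in>{..<k} - {i, j}. m < l} = l - ((if i < l then 1 else 0) + (if j < l then 1 else 0))" .
  have le: "(if i < l then 1 else 0) + (if j < l then 1 else 0) \<le> l" using assms by auto
  define t where "t = (if i < l then 1 else 0) + (if j < l then 1 else (0::nat))"
  have "even (l - t) = even (l + t)" using le unfolding t_def[symmetric] by simp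
  then have "(- 1 :: rat) ^ (l - t) = (-1) ^ (l + t)" by (cases "even (l + t)") auto
  then show ?thesis unfolding c t_def by (simp add: add.assoc)
qed

lemma sc_minus_left: "sc (- c) f = - sc c f"
  by (simp add: sc_def fun_eq_iff)

lemma d2_cycle_elt_Ideal:
  assumes v: "letter v" and circ: "is_circuit n vs"
  shows "d2 n (cycle_elt v vs) \<in> Ideal n"
proof -
  define k where "k = length vs"
  define N where "N S = eprod (map (omega_c vs) (filter (\<lambda>m. m \<notin> S) [0..<k]))" for S
  define A where "A = edge_difference v vs"
  define v' where "v' = (if v = X then Y else X)"
  define B where "B = edge_difference v' vs"
  \<comment> \<open>\<open>dgen\<close> has the x-difference in front. For \<open>v = Y\<close> the
    roles of the two letters are exchanged, and swapping the factors costs this sign.\<close>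
  define s :: rat where "s = (if v = X then 1 else -1)"
  have v': "letter v'" by (simp add: v'_def letter_def)
  have D: "dgen (cedge vs m) = sc s (emul (A m) (B m))" for m
  proof (cases "v = X")
    case False
    then have "v = Y" using v by (simp add: letter_def)
    then show ?thesis using deg1_anticommute[OF deg1_edge_difference deg1_edge_difference, of X vs m Y vs m] False
      by (simp add: dgen_cedge A_def B_def v'_def s_def sc_minus_left)
  qed (simp add: dgen_cedge A_def B_def v'_def s_def)
  have NL: "N S \<in> Lam n" for S
    unfolding N_def by (rule eprod_cedge_Lam[OF circ]) (auto simp: k_def)
  have om: "omega_minus vs i j = N {i, j}" for i j
    unfolding omega_minus_def N_def k_def by (simp add: insert_iff)
  have dN: "d2 n (N {i, j}) = (\<Sum>l\<in>{..<k} - {i, j}. sc ((-1) ^ card {m\<in>{..<k} - {i, j}. m < l})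
     (emul (dgen (cedge vs l)) (N {i, j, l})))" for i j
  proof -
    have set: "set (filter (\<lambda>m. m \<notin> {i, j}) [0..<k]) = {..<k} - {i, j}" by auto
    have f: "filter (\<lambda>m. m \<noteq> l) (filter (\<lambda>m. m \<notin> {i, j}) [0..<k]) = filter (\<lambda>m. m \<notin> {i, j, l}) [0..<k]" for l
      unfolding filter_filter by (rule filter_cong) auto
    show ?thesis
      unfolding N_def omega_c_cedge
      by (subst d2_eprod, intro sorted_wrt_filter sorted_wrt_upt)
        (simp_all only: set f, auto simp: k_def intro: cedge_Gens[OF circ])
  qed
  define F where "F i j l = sc (- s * (-1) ^ (i + j) * (-1) ^ card {m\<in>{..<k} - {i, j}. m < l})
     (emul (A i) (emul (emul (A l) (B l)) (N {i, j, l})))" for i j l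
  have "d2 n (cycle_elt v vs) = (\<Sum>(i, j)\<in>{(i, j). i < j \<and> j < k}. \<Sum>l\<in>{..<k} - {i, j}. F i j l)"
    unfolding cycle_elt_def d2_sum k_def[symmetric]
  proof (rule sum.cong)
    fix x assume "x \<in> {(i, j). i < j \<and> j < k}"
    then obtain i j where x: "x = (i, j)" "i < j" "j < k" by auto
    have "d2 n (sc ((-1) ^ (i + j)) (emul (A i) (N {i, j})))
      = sc ((-1) ^ (i + j)) (- emul (A i) (d2 n (N {i, j})))"
      unfolding d2_sc A_def using x by (subst d2_edge_difference[OF v circ _ NL]) (auto simp: k_def)
    also have "\<dots> = (\<Sum>l\<in>{..<k} - {i, j}. F i j l)"
      unfolding dN F_def D emul_sum_right emul_sc_right emul_sc_left ev.scale_minus_right ev.scale_sum_right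
        sum_negf[symmetric] sc_minus_left ev.scale_scale mult_minus_left
      by (rule sum.cong) (simp_all add: mult_ac)
    finally show "d2 n (case x of (i, j) \<Rightarrow> sc ((-1) ^ (i + j)) (emul (edge_difference v vs i) (omega_minus vs i j)))
       = (case x of (i, j) \<Rightarrow> \<Sum>l\<in>{..<k} - {i, j}. F i j l)"
      by (simp add: x om A_def)
  qed simp
  also have "\<dots> = (\<Sum>(p, q, r)\<in>{(p, q, r). p < q \<and> q < r \<and> r < k}. F p q r + F p r q + F q r p)"
    by (rule sum_pairs_compl_triples)
  also have "\<dots> \<in> Ideal n"
  proof (rule Ideal_sum)
    fix x assume "x \<in> {(p, q, r). p < q \<and> q < r \<and> r < k}"
    then obtain p q r where x: "x = (p, q, r)" and pqr: "p < q" "q < r" "r < k" by auto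
    define M where "M = N {p, q, r}"
    have sets: "{p, r, q} = {p, q, r}" "{q, r, p} = {p, q, r}" by auto
    \<comment> \<open>The minus sign comes from moving \<open>d2\<close> past the linear factor.
      Below \<open>l\<close> lie two, one or none of the deleted pair when \<open>l\<close> is
      \<open>r\<close>, \<open>q\<close> or \<open>p\<close>, which gives the signs +, -, + relative
      to \<open>c\<close> that \<open>triple_Ideal\<close> asks for.\<close>
    define c where "c = - s * (-1) ^ (p + q + r)"
    have "F p q r = sc c (emul (A p) (emul (emul (A r) (B r)) M))"
      using pqr unfolding F_def card_less_compl_pair[of p q r k] M_def c_def
      by (subst card_less_compl_pair) (auto simp: power_add)
    moreover have "F p r q = - sc c (emul (A p) (emul (emul (A q) (B q)) M))"
      using pqr unfolding F_def M_def c_def sets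
      by (subst card_less_compl_pair) (auto simp: power_add mult_ac sc_minus_left)
    moreover have "F q r p = sc c (emul (A q) (emul (emul (A p) (B p)) M))"
      using pqr unfolding F_def M_def c_def sets
      by (subst card_less_compl_pair) (auto simp: power_add mult_ac sc_minus_left)
    ultimately have "F p q r + F p r q + F q r p = sc c (emul (A p) (emul (emul (A r) (B r)) M)
       - emul (A p) (emul (emul (A q) (B q)) M) + emul (A q) (emul (emul (A p) (B p)) M))"
      by (simp add: ev.scale_right_distrib ev.scale_right_diff_distrib)
    also have "\<dots> \<in> Ideal n"
    proof (intro Ideal_sc triple_Ideal[where k = k])
      fix m assume m: "m < k" "m \<notin> {p, q, r}"
      then have "m \<in> set (filter (\<lambda>m. m \<notin> {p, q, r}) [0..<k])" by auto
      then show "emul (A m) M \<in> Ideal n \<and> emul (B m) M \<in> Ideal n"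
        unfolding A_def B_def M_def N_def
        by (intro conjI edge_difference_eprod_Ideal v v' circ) (auto simp: k_def)
    qed (use pqr sum_edge_difference[of v vs] sum_edge_difference[of v' vs] edge_difference_Lam[OF v circ] edge_difference_Lam[OF v' circ] in
       \<open>simp_all add: A_def B_def k_def\<close>)
    finally show "(case x of (p, q, r) \<Rightarrow> F p q r + F p r q + F q r p) \<in> Ideal n" by (simp add: x)
  qed
  finally show ?thesis .
qed

section \<open>Bidegree of the cycle elements\<close>

lemma subspace_Lam_bideg: "ev.subspace (Lam_bideg n p q)"
proof (rule ev.subspaceI)
  fix f g assume fg: "f \<in> Lam_bideg n p q" "g \<in> Lam_bideg n p q"
  have "U \<subseteq> Gens n \<and> int (card {g\<in>U. \<not> isW g}) = p \<and> card {g\<in>U. isW g} = q" if "(f + g) U \<noteq> 0" for U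
    using that fg unfolding Lam_bideg_def by (cases "f U = 0") auto
  then show "f + g \<in> Lam_bideg n p q" by (simp add: Lam_bideg_def)
qed (auto simp: Lam_bideg_def sc_def)

lemma Lam_bideg_emul:
  assumes "f \<in> Lam_bideg n p q" "g \<in> Lam_bideg n p' q'"
  shows "emul f g \<in> Lam_bideg n (p + p') (q + q')"
proof -
  have "U \<subseteq> Gens n \<and> int (card {g\<in>U. \<not> isW g}) = p + p' \<and> card {g\<in>U. isW g} = q + q'"
    if "emul f g U \<noteq> 0" for U
  proof -
    from that obtain S where S: "S \<in> Pow U" "esign S (U - S) * f S * g (U - S) \<noteq> 0"
      unfolding emul_def by (meson sum.neutral)
    then have "f S \<noteq> 0" "g (U - S) \<noteq> 0" by auto
    with assms have 1: "S \<subseteq> Gens n" "int (card {g\<in>S. \<not> isW g}) = p" "card {g\<in>S. isW g} = q"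
      and 2: "U - S \<subseteq> Gens n" "int (card {g\<in>U - S. \<not> isW g}) = p'" "card {g\<in>U - S. isW g} = q'"
      unfolding Lam_bideg_def by blast+
    have fin: "finite S" "finite (U - S)" using 1 2 finite_Gens[of n] infinite_super by blast+
    have c: "card {g\<in>U. P g} = card {g\<in>S. P g} + card {g\<in>U - S. P g}" for P
    proof -
      have "{g\<in>U. P g} = {g\<in>S. P g} \<union> {g\<in>U - S. P g}" using S(1) by auto
      then show ?thesis using fin by (simp only:) (rule card_Un_disjoint, auto)
    qed
    from 1 2 S(1) show ?thesis by (auto simp: c[of isW] c[of "\<lambda>g. \<not> isW g"])
  qed
  then show ?thesis by (simp add: Lam_bideg_def)
qed

lemma egen_W_bideg: "g \<in> Gens n \<Longrightarrow> isW g \<Longrightarrow> egen g \<in> Lam_bideg n 0 1"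
  and egen_not_W_bideg: "g \<in> Gens n \<Longrightarrow> \<not> isW g \<Longrightarrow> egen g \<in> Lam_bideg n 1 0"
proof -
  have "{h\<in>{g}. P h} = (if P g then {g} else {})" for P by auto
  then show "g \<in> Gens n \<Longrightarrow> isW g \<Longrightarrow> egen g \<in> Lam_bideg n 0 1"
    and "g \<in> Gens n \<Longrightarrow> \<not> isW g \<Longrightarrow> egen g \<in> Lam_bideg n 1 0"
    by (auto simp: Lam_bideg_def egen_def)
qed

lemma eprod_cedge_bideg:
  assumes "is_circuit n vs" "set ms \<subseteq> {..<length vs}"
  shows "eprod (map (omega_c vs) ms) \<in> Lam_bideg n 0 (length ms)"
  using assms(2)
proof (induction ms)
  case Nil
  show ?case by (auto simp: Lam_bideg_def eone_def)
next
  case (Cons m ms)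
  have "omega_c vs m \<in> Lam_bideg n 0 1"
    unfolding omega_c_cedge using Cons.prems
    by (intro egen_W_bideg cedge_Gens assms) (auto simp: cedge_def egW_def)
  moreover have "eprod (map (omega_c vs) ms) \<in> Lam_bideg n 0 (length ms)" using Cons by simp
  ultimately have "emul (omega_c vs m) (eprod (map (omega_c vs) ms)) \<in> Lam_bideg n (0 + 0) (1 + length ms)"
    by (rule Lam_bideg_emul)
  then show ?case by simp
qed

lemma cycle_elt_bideg:
  assumes v: "letter v" and circ: "is_circuit n vs"
  shows "cycle_elt v vs \<in> Lam_bideg n 1 (length vs - 2)"
  unfolding cycle_elt_def
proof (rule ev.subspace_sum[OF subspace_Lam_bideg])
  fix x assume "x \<in> {(i, j). i < j \<and> j < length vs}"
  then obtain i j where x: "x = (i, j)" "i < j" "j < length vs" by auto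
  have notW: "\<not> isW (v a)" for a using v by (auto simp: letter_def)
  have "edge_difference v vs i \<in> Lam_bideg n 1 0"
    unfolding edge_difference_def using x v circuit_verts[OF circ, of i]
    by (intro ev.subspace_diff[OF subspace_Lam_bideg] egen_not_W_bideg notW) simp_all
  moreover have "omega_minus vs i j \<in> Lam_bideg n 0 (length vs - 2)"
  proof -
    let ?ms = "filter (\<lambda>m. m \<noteq> i \<and> m \<noteq> j) [0..<length vs]"
    have "length ?ms = card (set ?ms)" by (rule distinct_card[symmetric]) simp
    also have "set ?ms = {..<length vs} - {i, j}" by auto
    also have "card \<dots> = length vs - 2" using x by (subst card_Diff_subset) auto
    finally have "length ?ms = length vs - 2" .
    then show ?thesis using eprod_cedge_bideg[OF circ, of ?ms] by (simp add: omega_minus_def subset_iff)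
  qed
  ultimately have "emul (edge_difference v vs i) (omega_minus vs i j) \<in> Lam_bideg n (1 + 0) (0 + (length vs - 2))"
    by (rule Lam_bideg_emul)
  then show "(case x of (i, j) \<Rightarrow> sc ((- 1) ^ (i + j)) (emul (edge_difference v vs i) (omega_minus vs i j)))
      \<in> Lam_bideg n 1 (length vs - 2)"
    by (simp add: x ev.subspace_scale[OF subspace_Lam_bideg])
qed

subsection \<open>Functionals from labellings of the generators\<close>

definition inversions :: "(gen \<Rightarrow> nat) \<Rightarrow> gen set \<Rightarrow> nat" where
  "inversions \<phi> U = card {(g, h). g \<in> U \<and> h \<in> U \<and> rank g < rank h \<and> \<phi> h < \<phi> g}"

text \<open>The coefficient of \<open>u\<^sub>0 \<dots> u\<^sub>K\<^sub>-\<^sub>1\<close> in the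
  image of \<open>mono U\<close> when each \<open>g\<close> is sent to the generator indexed by
  \<open>\<phi> g\<close>: every label must occur once, and the sign is that of sorting the factors
  from rank order into label order. Labels from \<open>K\<close> on mean that the generator is sent
  to 0.\<close>

definition label_coeff :: "(gen \<Rightarrow> nat) \<Rightarrow> nat \<Rightarrow> gen set \<Rightarrow> rat" where
  "label_coeff \<phi> K U = (if bij_betw \<phi> U {..<K} then (-1) ^ inversions \<phi> U else 0)"

definition label_functional :: "nat \<Rightarrow> (gen \<Rightarrow> nat) \<Rightarrow> nat \<Rightarrow> elt \<Rightarrow> rat" where
  "label_functional n \<phi> K f = (\<Sum>U\<in>Pow (Gens n). f U * label_coeff \<phi> K U)"

text \<open>The same coefficient for the image of \<open>mono S\<close> followed by the generator of
  label \<open>c\<close>: \<open>S\<close> has to supply all other labels, and the last factor moves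
  left past the greater ones.\<close>

definition label_coeff_without :: "(gen \<Rightarrow> nat) \<Rightarrow> nat \<Rightarrow> nat \<Rightarrow> gen set \<Rightarrow> rat" where
  "label_coeff_without \<phi> K c S = (if c < K \<and> bij_betw \<phi> S ({..<K} - {c})
     then (-1) ^ (inversions \<phi> S + card {a\<in>S. c < \<phi> a}) else 0)"

lemma label_functional_add: "label_functional n \<phi> K (f + g) = label_functional n \<phi> K f + label_functional n \<phi> K g"
  by (simp add: label_functional_def algebra_simps sum.distrib)
lemma label_functional_diff: "label_functional n \<phi> K (f - g) = label_functional n \<phi> K f - label_functional n \<phi> K g"
  by (simp add: label_functional_def algebra_simps sum_subtractf)
lemma label_functional_minus: "label_functional n \<phi> K (- f) = - label_functional n \<phi> K f"
  by (simp add: label_functional_def sum_negf)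
lemma label_functional_sc: "label_functional n \<phi> K (sc c f) = c * label_functional n \<phi> K f"
  by (simp add: label_functional_def sc_def sum_distrib_left mult.assoc)
lemma label_functional_0 [simp]: "label_functional n \<phi> K 0 = 0"
  by (simp add: label_functional_def)
lemma label_functional_sum: "label_functional n \<phi> K (\<Sum>i\<in>I. f i) = (\<Sum>i\<in>I. label_functional n \<phi> K (f i))"
  by (induction I rule: infinite_finite_induct)
    (simp_all only: sum.infinite sum.empty sum.insert label_functional_add label_functional_0 not_False_eq_True)

lemma inversions_insert:
  assumes "finite S" "g \<notin> S"
  shows "inversions \<phi> (insert g S) = inversions \<phi> S + card {a\<in>S. rank a < rank g \<and> \<phi> g < \<phi> a}
     + card {a\<in>S. rank g < rank a \<and> \<phi> a < \<phi> g}"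
proof -
  let ?A = "{(u, h). u \<in> S \<and> h \<in> S \<and> rank u < rank h \<and> \<phi> h < \<phi> u}"
  let ?B = "(\<lambda>a. (a, g)) ` {a\<in>S. rank a < rank g \<and> \<phi> g < \<phi> a}"
  let ?C = "(\<lambda>a. (g, a)) ` {a\<in>S. rank g < rank a \<and> \<phi> a < \<phi> g}"
  have "finite ?A" by (rule finite_subset[of _ "S \<times> S"]) (use assms in auto)
  moreover have "finite ?B" "finite ?C" using assms by auto
  moreover have "{(u, h). u \<in> insert g S \<and> h \<in> insert g S \<and> rank u < rank h \<and> \<phi> h < \<phi> u} = (?A \<union> ?B) \<union> ?C"
    by auto
  moreover have "?A \<inter> ?B = {}" "(?A \<union> ?B) \<inter> ?C = {}" using assms by auto
  ultimately have "inversions \<phi> (insert g S) = card ?A + card ?B + card ?C"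
    unfolding inversions_def by (simp only:) (simp only: card_Un_disjoint finite_UnI)
  then show ?thesis by (simp add: card_image inj_on_def inversions_def)
qed

text \<open>Elements of greater rank and smaller label are counted twice, once as a reordering sign
  and once as an inversion, and cancel. What survives counts the elements of greater label and no
  longer mentions the rank of \<open>g\<close>.\<close>

lemma label_coeff_insert:
  assumes "finite S" "g \<notin> S"
  shows "(-1) ^ card {u\<in>S. rank g < rank u} * label_coeff \<phi> K (insert g S) = label_coeff_without \<phi> K (\<phi> g) S"
proof (cases "\<phi> g < K \<and> bij_betw \<phi> S ({..<K} - {\<phi> g})")
  case True
  have "insert (\<phi> g) ({..<K} - {\<phi> g}) = {..<K}" using True by auto
  then have bij: "bij_betw \<phi> (insert g S) {..<K}"
    using notIn_Un_bij_betw[OF assms(2), of \<phi> "{..<K} - {\<phi> g}"] True by auto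
  have ne: "\<phi> a \<noteq> \<phi> g" if "a \<in> S" for a
    using True that by (auto simp: bij_betw_def)
  have ra: "rank a < rank g \<or> rank g < rank a" if "a \<in> S" for a
  proof -
    have "rank a \<noteq> rank g" using that assms(2) by auto
    then show ?thesis by linarith
  qed
  have "{u\<in>S. rank g < rank u} = {a\<in>S. rank g < rank a \<and> \<phi> a < \<phi> g} \<union> {a\<in>S. rank g < rank a \<and> \<phi> g < \<phi> a}"
    using ne by (auto simp: neq_iff)
  moreover have "{a\<in>S. \<phi> g < \<phi> a} = {a\<in>S. rank a < rank g \<and> \<phi> g < \<phi> a} \<union> {a\<in>S. rank g < rank a \<and> \<phi> g < \<phi> a}"
    using ra by blast
  moreover have "card ({a\<in>S. rank g < rank a \<and> \<phi> a < \<phi> g} \<union> {a\<in>S. rank g < rank a \<and> \<phi> g < \<phi> a})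
    = card {a\<in>S. rank g < rank a \<and> \<phi> a < \<phi> g} + card {a\<in>S. rank g < rank a \<and> \<phi> g < \<phi> a}"
    by (rule card_Un_disjoint) (use assms in auto)
  moreover have "card ({a\<in>S. rank a < rank g \<and> \<phi> g < \<phi> a} \<union> {a\<in>S. rank g < rank a \<and> \<phi> g < \<phi> a})
    = card {a\<in>S. rank a < rank g \<and> \<phi> g < \<phi> a} + card {a\<in>S. rank g < rank a \<and> \<phi> g < \<phi> a}"
    by (rule card_Un_disjoint) (use assms in auto)
  ultimately have c: "card {u\<in>S. rank g < rank u} = card {a\<in>S. rank g < rank a \<and> \<phi> a < \<phi> g} + card {a\<in>S. rank g < rank a \<and> \<phi> g < \<phi> a}"
    "card {a\<in>S. \<phi> g < \<phi> a} = card {a\<in>S. rank a < rank g \<and> \<phi> g < \<phi> a} + card {a\<in>S. rank g < rank a \<and> \<phi> g < \<phi> a}"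
    by (simp_all only:)
  show ?thesis
    using True bij unfolding label_coeff_def label_coeff_without_def inversions_insert[OF assms] c power_add
    by (simp add: mult_ac)
next
  case False
  have "\<not> bij_betw \<phi> (insert g S) {..<K}"
  proof
    assume b: "bij_betw \<phi> (insert g S) {..<K}"
    then have "\<phi> g < K" by (auto simp: bij_betw_def)
    moreover have "\<phi> g \<notin> \<phi> ` S" "insert (\<phi> g) (\<phi> ` S) = {..<K}" "inj_on \<phi> S"
      using b assms(2) by (auto simp: bij_betw_def)
    then have "bij_betw \<phi> S ({..<K} - {\<phi> g})"
      by (metis Diff_insert_absorb bij_betw_def)
    ultimately show False using False by simp
  qed
  with False show ?thesis by (auto simp: label_coeff_def label_coeff_without_def)
qed

text \<open>Multiplying by a generator on the right is seen by the functional only through the label of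
  the generator; this is what makes it vanish on the Arnold relations.\<close>
lemma label_functional_right:
  assumes "g \<in> Gens n"
  shows "label_functional n \<phi> K (emul f (egen g)) = (\<Sum>S\<in>Pow (Gens n). f S * label_coeff_without \<phi> K (\<phi> g) S)"
proof -
  have fin: "finite U" if "U \<in> Pow (Gens n)" for U using that finite_subset[OF _ finite_Gens, of U n] by simp
  have "label_functional n \<phi> K (emul f (egen g)) = (\<Sum>U\<in>{U\<in>Pow (Gens n). g \<in> U}.
     (-1) ^ card {u\<in>U. rank g < rank u} * f (U - {g}) * label_coeff \<phi> K U)"
    unfolding label_functional_def
    by (rule sum.mono_neutral_cong_right) (auto simp: emul_egen_right fin)
  also have "\<dots> = (\<Sum>S\<in>{S\<in>Pow (Gens n). g \<notin> S}. f S * label_coeff_without \<phi> K (\<phi> g) S)"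
  proof (rule sum.reindex_bij_witness[where i = "insert g" and j = "\<lambda>U. U - {g}"], goal_cases)
    case (5 U)
    define S where "S = U - {g}"
    have S: "U = insert g S" "g \<notin> S" "finite S" using 5 fin by (auto simp: S_def)
    have e: "{u\<in>insert g S. rank g < rank u} = {u\<in>S. rank g < rank u}" by auto
    have "f S * label_coeff_without \<phi> K (\<phi> g) S = (-1) ^ card {u\<in>insert g S. rank g < rank u} * f S * label_coeff \<phi> K (insert g S)"
      unfolding label_coeff_insert[OF S(3,2), symmetric] e by (simp only: mult_ac)
    then show ?case by (simp only: S_def[symmetric] S(1)[symmetric])
  qed (use assms in auto)
  also have "\<dots> = (\<Sum>S\<in>Pow (Gens n). f S * label_coeff_without \<phi> K (\<phi> g) S)"
    by (rule sum.mono_neutral_left) (auto simp: label_coeff_without_def bij_betw_def)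
  finally show ?thesis .
qed

lemma label_functional_right_cong:
  assumes "g \<in> Gens n" "h \<in> Gens n" "\<phi> g = \<phi> h"
  shows "label_functional n \<phi> K (emul f (egen g)) = label_functional n \<phi> K (emul f (egen h))"
  using assms by (simp add: label_functional_right)

lemma label_functional_right_zero:
  assumes "g \<in> Gens n" "K \<le> \<phi> g"
  shows "label_functional n \<phi> K (emul f (egen g)) = 0"
  using assms by (simp add: label_functional_right label_coeff_without_def)

text \<open>Generators with equal labels are interchangeable in the last place, so the product is
  seen as a square.\<close>

lemma label_functional_right_same_label:
  assumes "g \<in> Gens n" "h \<in> Gens n" "\<phi> g = \<phi> h"
  shows "label_functional n \<phi> K (emul f (emul (egen g) (egen h))) = 0"
proof -
  have "label_functional n \<phi> K (emul f (emul (egen g) (egen h))) = label_functional n \<phi> K (emul f (emul (egen g) (egen g)))"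
    using label_functional_right_cong[OF assms(2,1), of \<phi> K "emul f (egen g)"] assms(3) by (simp add: emul_assoc)
  then show ?thesis by (simp add: deg1_square)
qed

text \<open>For a letter relation, either the edge is out of range, or both of its ends have
  position below \<open>K\<close> and then both letters are out of range. In an Arnold relation the
  two edges at the vertex of greatest position share their label: their product is not seen, and the
  other two products cancel.\<close>

lemma label_functional_Ideal:
  assumes W: "\<And>i j. \<phi> (egW i j) = max (pos i) (pos j)"
    and v: "\<And>v i. letter v \<Longrightarrow> pos i < K \<Longrightarrow> K \<le> \<phi> (v i)"
    and "f \<in> Ideal n"
  shows "label_functional n \<phi> K f = 0"
  using assms(3)
proof (induction rule: Ideal_induct)
  case (base f r)
  consider (x) v i j where "letter v" "r = emul (egen (v i) - egen (v j)) (wg i j)" "i \<in> {1..n}" "j \<in> {1..n}" "i \<noteq> j"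
    | (a) i j k where "r = emul (wg i j) (wg j k) + emul (wg j k) (wg k i) + emul (wg k i) (wg i j)"
       "i \<in> {1..n}" "j \<in> {1..n}" "k \<in> {1..n}" "i \<noteq> j" "j \<noteq> k" "i \<noteq> k"
    using base(2) unfolding rels_def xg_def yg_def letter_def by blast
  then show ?case
  proof cases
    case x
    have w: "egW i j \<in> Gens n" using x by (intro egW_Gens)
    show ?thesis
    proof (cases "\<phi> (egW i j) < K")
      case True
      then have "K \<le> \<phi> (v i)" "K \<le> \<phi> (v j)" using v[OF x(1)] by (auto simp: W)
      then have "label_functional n \<phi> K (emul (emul f (wg i j)) (egen (v i))) = 0"
         "label_functional n \<phi> K (emul (emul f (wg i j)) (egen (v j))) = 0"
        using x by (auto intro!: label_functional_right_zero)
      moreover have "emul f r = - (emul (emul f (wg i j)) (egen (v i)) - emul (emul f (wg i j)) (egen (v j)))"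
      proof -
        have "r = - emul (wg i j) (egen (v i) - egen (v j))"
          unfolding x(2) by (rule deg1_anticommute) simp_all
        then show ?thesis by (simp only: emul_linear emul_assoc)
      qed
      ultimately show ?thesis by (simp only: label_functional_minus label_functional_diff)
    next
      case False
      then show ?thesis using label_functional_right_zero[OF w, of K \<phi> "emul f (egen (v i) - egen (v j))"]
        by (simp add: x(2) emul_assoc wg_egW)
    qed
  next
    case a
    have arnold: "label_functional n \<phi> K (emul f (emul (wg i j) (wg j k) + emul (wg j k) (wg k i) + emul (wg k i) (wg i j))) = 0"
      if "i \<in> {1..n}" "j \<in> {1..n}" "k \<in> {1..n}" "i \<noteq> j" "j \<noteq> k" "i \<noteq> k" "pos i \<le> pos k" "pos j \<le> pos k" for i j k
    proof -
      have G: "egW i j \<in> Gens n" "egW j k \<in> Gens n" "egW k i \<in> Gens n" using that by (auto intro!: egW_Gens)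
      have eq: "\<phi> (egW j k) = \<phi> (egW k i)" using that by (simp add: W)
      have "emul (wg k i) (wg i j) = - emul (wg i j) (wg k i)"
        by (rule deg1_anticommute) simp_all
      then have "label_functional n \<phi> K (emul f (emul (wg i j) (wg j k) + emul (wg j k) (wg k i) + emul (wg k i) (wg i j)))
        = label_functional n \<phi> K (emul (emul f (wg i j)) (wg j k)) + label_functional n \<phi> K (emul f (emul (wg j k) (wg k i)))
          - label_functional n \<phi> K (emul (emul f (wg i j)) (wg k i))"
        by (simp only: emul_add_right emul_minus_right emul_assoc label_functional_add label_functional_minus)
      also have "\<dots> = 0"
        using label_functional_right_cong[OF G(2,3) eq] label_functional_right_same_label[OF G(2,3) eq] by (simp add: wg_egW)
      finally show ?thesis .
    qed
    \<comment> \<open>The relation is invariant under cyclic renaming, so the vertex of greatest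
      position may be taken to be the third one.\<close>
    consider "pos i \<le> pos k \<and> pos j \<le> pos k" | "pos j \<le> pos i \<and> pos k \<le> pos i" | "pos k \<le> pos j \<and> pos i \<le> pos j"
      by linarith
    then show ?thesis
    proof cases
      case 1
      then show ?thesis using arnold[of i j k] a by simp
    next
      case 2
      have "r = emul (wg j k) (wg k i) + emul (wg k i) (wg i j) + emul (wg i j) (wg j k)"
        unfolding a(1) by (simp only: add.commute add.left_commute)
      then show ?thesis using arnold[of j k i] a(2-) 2 by (simp only:) blast
    next
      case 3
      have "r = emul (wg k i) (wg i j) + emul (wg i j) (wg j k) + emul (wg j k) (wg k i)"
        unfolding a(1) by (simp only: add.commute add.left_commute)
      then show ?thesis using arnold[of k i j] a(2-) 3 by (simp only:) blast
    qed
  qed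
qed (simp_all only: label_functional_0 label_functional_add label_functional_sc add_0 mult_zero_right)

lemma label_functional_mono: "U \<subseteq> Gens n \<Longrightarrow> label_functional n \<phi> K (mono U) = label_coeff \<phi> K U"
  unfolding label_functional_def by (subst sum.mono_neutral_cong_right[where S = "{U}" and h = "\<lambda>V. label_coeff \<phi> K V"]) (auto simp: mono_def)

lemma emul_egen_mono:
  assumes "finite U" "g \<notin> U"
  shows "emul (egen g) (mono U) = sc ((-1) ^ card {u\<in>U. rank u < rank g}) (mono (insert g U))"
  unfolding mono_insert[OF assms] ev.scale_scale by (simp flip: power_add)

text \<open>The sign is left unspecified because only the nonvanishing of functional values is
  used.\<close>

lemma eprod_egen_mono:
  assumes "distinct gs"
  shows "\<exists>c\<in>{1, -1}. eprod (map egen gs) = sc c (mono (set gs))"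
  using assms
proof (induction gs)
  case Nil
  show ?case by (simp add: mono_empty)
next
  case (Cons g gs)
  then obtain c where c: "c \<in> {1, -1}" "eprod (map egen gs) = sc c (mono (set gs))"
    by (meson distinct.simps(2))
  let ?s = "(-1) ^ card {u\<in>set gs. rank u < rank g} :: rat"
  have "eprod (map egen (g # gs)) = sc (c * ?s) (mono (set (g # gs)))"
    using Cons.prems by (simp add: c(2) emul_sc_right emul_egen_mono)
  moreover have "c * ?s \<in> {1, -1}" using c(1) by (cases "even (card {u\<in>set gs. rank u < rank g})") auto
  ultimately show ?case by blast
qed

lemma label_functional_egen_eprod:
  assumes "distinct gs" "g \<notin> set gs" "insert g (set gs) \<subseteq> Gens n"
  shows "label_functional n \<phi> K (emul (egen g) (eprod (map egen gs))) \<noteq> 0 \<longleftrightarrow> bij_betw \<phi> (insert g (set gs)) {..<K}"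
proof -
  obtain c where c: "c \<in> {1, -1}" "eprod (map egen gs) = sc c (mono (set gs))"
    using eprod_egen_mono[OF assms(1)] by blast
  show ?thesis
    using assms c(1) by (auto simp: c(2) emul_sc_right emul_egen_mono label_functional_sc label_functional_mono label_coeff_def)
qed

subsection \<open>Edges of circuits\<close>

definition edge_at :: "nat list \<Rightarrow> nat \<Rightarrow> nat set" where
  "edge_at vs m = {csrc vs m, ctgt vs m}"

lemma cycle_of_edge_at: "cycle_of vs = edge_at vs ` {..<length vs}"
  by (auto simp: cycle_of_def edge_at_def)

text \<open>Two indices with the same edge but different sources traverse it in opposite directions,
  so each is the successor of the other and \<open>m = (m + 2) mod length vs\<close>; a length of at
  least 3 excludes this.\<close>

lemma inj_on_edge_at:
  assumes "is_circuit n vs"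
  shows "inj_on (edge_at vs) {..<length vs}"
proof (rule inj_onI)
  let ?k = "length vs"
  have k: "?k \<ge> 3" and d: "distinct vs" using assms by (auto simp: is_circuit_def)
  fix m m' assume m: "m \<in> {..<?k}" "m' \<in> {..<?k}" and e: "edge_at vs m = edge_at vs m'"
  show "m = m'"
  proof (rule ccontr)
    assume "m \<noteq> m'"
    have lt: "(i + 1) mod ?k < ?k" for i using k by (intro mod_less_divisor) linarith
    have "vs ! m \<noteq> vs ! m'" using d m \<open>m \<noteq> m'\<close> by (simp add: nth_eq_iff_index_eq)
    with e have "vs ! m = vs ! ((m' + 1) mod ?k)" "vs ! m' = vs ! ((m + 1) mod ?k)"
      by (auto simp: edge_at_def csrc_def ctgt_def doubleton_eq_iff)
    then have "m = (m' + 1) mod ?k" "m' = (m + 1) mod ?k"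
      using d m lt by (simp_all add: nth_eq_iff_index_eq del: mod_less_divisor)
    then have "m = (m + 2) mod ?k" by (simp add: mod_Suc_eq)
    then show False
    proof (cases "m + 2 < ?k")
      case False
      then have "(m + 2) mod ?k = m + 2 - ?k" using m k by (simp add: mod_if)
      with \<open>m = (m + 2) mod ?k\<close> False k show False by linarith
    qed simp
  qed
qed

lemma cycle_of_simps:
  assumes "is_circuit n vs"
  shows "card (cycle_of vs) = length vs" "\<Union>(cycle_of vs) = set vs" "finite (cycle_of vs)"
    "e \<in> cycle_of vs \<Longrightarrow> \<exists>u w. e = {u, w} \<and> u \<noteq> w"
proof -
  show "card (cycle_of vs) = length vs"
    unfolding cycle_of_edge_at using card_image[OF inj_on_edge_at[OF assms]] by simp
  show "finite (cycle_of vs)" by (simp add: cycle_of_edge_at)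
  show "e \<in> cycle_of vs \<Longrightarrow> \<exists>u w. e = {u, w} \<and> u \<noteq> w"
    using circuit_verts(3)[OF assms] by (auto simp: cycle_of_def)
  have k: "length vs \<ge> 3" using assms by (auto simp: is_circuit_def)
  have lt: "(i + 1) mod length vs < length vs" for i using k by (intro mod_less_divisor) linarith
  show "\<Union>(cycle_of vs) = set vs"
  proof
    show "\<Union>(cycle_of vs) \<subseteq> set vs" using lt by (auto simp: cycle_of_def csrc_def ctgt_def)
    show "set vs \<subseteq> \<Union>(cycle_of vs)" by (fastforce simp: cycle_of_edge_at edge_at_def csrc_def in_set_conv_nth)
  qed
qed

lemma circuit_degree_index:
  assumes "is_circuit n vs" "u \<in> set vs"
  shows "card {m. m < length vs \<and> u \<in> edge_at vs m} = 2"
proof -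
  let ?k = "length vs"
  have k: "?k \<ge> 3" and d: "distinct vs" using assms by (auto simp: is_circuit_def)
  have lt: "(i + 1) mod ?k < ?k" for i using k by (intro mod_less_divisor) linarith
  obtain p where p: "p < ?k" "u = vs ! p" using assms(2) by (auto simp: in_set_conv_nth)
  have iff: "u \<in> edge_at vs m \<longleftrightarrow> m = p \<or> (m + 1) mod ?k = p" if "m < ?k" for m
    using that p d lt[of m] by (auto simp: edge_at_def csrc_def ctgt_def nth_eq_iff_index_eq)
  define p' where "p' = (if p = 0 then ?k - 1 else p - 1)"
  have "(m + 1) mod ?k = p \<longleftrightarrow> m = p'" if "m < ?k" for m
  proof (cases "m + 1 = ?k")
    case True
    then show ?thesis using p k by (auto simp: p'_def)
  next
    case False
    then show ?thesis using that p k by (auto simp: p'_def)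
  qed
  then have "{m. m < ?k \<and> u \<in> edge_at vs m} = {p, p'}"
    using iff p k by (auto simp: p'_def)
  moreover have "p \<noteq> p'" using k by (auto simp: p'_def)
  ultimately show ?thesis by simp
qed

lemma circuit_degree:
  assumes "is_circuit n vs" "u \<in> set vs"
  shows "card {e \<in> cycle_of vs. u \<in> e} = 2"
proof -
  have "{e \<in> cycle_of vs. u \<in> e} = edge_at vs ` {m. m < length vs \<and> u \<in> edge_at vs m}"
    by (auto simp: cycle_of_edge_at)
  moreover have "inj_on (edge_at vs) {m. m < length vs \<and> u \<in> edge_at vs m}"
    by (rule inj_on_subset[OF inj_on_edge_at[OF assms(1)]]) auto
  ultimately show ?thesis using circuit_degree_index[OF assms] by (simp add: card_image)
qed

section \<open>Positions along a path and the edge labels they induce\<close>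

definition pos :: "nat list \<Rightarrow> nat \<Rightarrow> nat" where
  "pos s u = length (takeWhile (\<lambda>w. w \<noteq> u) s)"

lemma pos_less_iff: "pos s u < length s \<longleftrightarrow> u \<in> set s"
  unfolding pos_def by (induction s) auto

lemma pos_le: "pos s u \<le> length s"
  by (simp add: pos_def length_takeWhile_le)

lemma nth_pos: "u \<in> set s \<Longrightarrow> s ! pos s u = u"
  unfolding pos_def by (induction s) auto

lemma pos_nth: "distinct s \<Longrightarrow> i < length s \<Longrightarrow> pos s (s ! i) = i"
  by (metis nth_eq_iff_index_eq nth_mem nth_pos pos_less_iff)

text \<open>The normal form of a standard circuit: it starts at its greatest vertex and steps first
  to the second greatest.\<close>

definition top2 :: "nat \<Rightarrow> nat list \<Rightarrow> bool" where
  "top2 a s \<longleftrightarrow> a = Max (set (a # s)) \<and> s ! 0 = Max (set (a # s) - {a})"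

lemma cycle_of_Cons:
  assumes "is_circuit n (a # s)"
  shows "cycle_of (a # s) = insert {a, s ! 0} (insert {s ! (length s - 1), a} ((\<lambda>j. {s ! (j - 1), s ! j}) ` {1..<length s}))"
proof -
  have k: "length s \<ge> 2" using assms by (auto simp: is_circuit_def)
  then have ne: "s \<noteq> []" by auto
  have "{..<length (a # s)} = insert 0 (insert (length s) {1..<length s})" using k by auto
  then have "cycle_of (a # s) = insert (edge_at (a # s) 0) (insert (edge_at (a # s) (length s)) (edge_at (a # s) ` {1..<length s}))"
    unfolding cycle_of_edge_at by (simp only: image_insert)
  also have "edge_at (a # s) 0 = {a, s ! 0}" using ne by (simp add: edge_at_def csrc_def ctgt_def)
  also have "edge_at (a # s) (length s) = {s ! (length s - 1), a}"
    using ne by (simp add: edge_at_def csrc_def ctgt_def nth_Cons')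
  also have "edge_at (a # s) ` {1..<length s} = (\<lambda>j. {s ! (j - 1), s ! j}) ` {1..<length s}"
    by (rule image_cong) (auto simp: edge_at_def csrc_def ctgt_def nth_Cons')
  finally show ?thesis .
qed

text \<open>The edge labels of a path that starts at the first vertex of \<open>s\<close> and visits all of \<open>s\<close> are
  bijective only if the path is \<open>s\<close> itself: every vertex but the first has a unique parent of smaller
  position, and since degrees are at most two, no vertex is the parent of two others.\<close>
lemma cycle_eq_of_bij:
  assumes C: "is_circuit n C" and stC: "standard_cycle (cycle_of C)" and aC: "a \<in> set C"
    and as: "is_circuit n (a # s)" and top: "top2 a s"
    and bij: "bij_betw (\<lambda>e. Max (pos s ` e)) {e\<in>cycle_of C. a \<notin> e} {1..<length s}"
  shows "cycle_of C = cycle_of (a # s)"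
proof -
  define E where "E = cycle_of C"
  define K where "K = length s"
  define M where "M = {e\<in>E. a \<notin> e}"
  note C' = cycle_of_simps[OF C, folded E_def] 
  have K: "K \<ge> 2" and ds: "distinct s" and as': "a \<notin> set s" using as by (auto simp: is_circuit_def K_def)
  have bij': "bij_betw (\<lambda>e. Max (pos s ` e)) M {1..<K}" using bij by (simp add: M_def E_def K_def)
  have deg: "card {e\<in>E. u \<in> e} = 2" if "u \<in> set C" for u
    using circuit_degree[OF C that] by (simp add: E_def)
  have finE: "finite E" by (rule C')
  \<comment> \<open>There are \<open>K - 1\<close> labels on the edges avoiding \<open>a\<close>,
    and two edges at \<open>a\<close>. Hence \<open>C\<close> has as many vertices as
    \<open>a # s\<close>, and an inclusion of vertex sets will suffice for equality.\<close>
  have "E = M \<union> {e\<in>E. a \<in> e}" by (auto simp: M_def)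
  then have "card E = card M + card {e\<in>E. a \<in> e}"
    using finE by (metis (no_types, lifting) M_def card_Un_disjoint disjoint_iff finite_Un mem_Collect_eq)
  moreover have "card M = K - 1" using bij_betw_same_card[OF bij'] by simp
  ultimately have lenC: "length C = K + 1" using deg[OF aC] C'(1) K by simp
  have dC: "distinct C" using C by (simp add: is_circuit_def)
  have edge2: "e = {u, w}" if "e \<in> E" "u \<in> e" "w \<in> e" "u \<noteq> w" for e u w
    using C'(4)[OF that(1)] that by auto
  have two: "\<exists>e f. e \<in> E \<and> f \<in> E \<and> u \<in> e \<and> u \<in> f \<and> e \<noteq> f" if "u \<in> set C" for u
    using deg[OF that] unfolding card_2_iff by (metis (no_types, lifting) insertI1 insert_subset mem_Collect_eq order_refl)
  have at_most_two: False if "e \<in> E" "f \<in> E" "g \<in> E" "u \<in> e" "u \<in> f" "u \<in> g" "e \<noteq> f" "e \<noteq> g" "f \<noteq> g" for e f g u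
  proof -
    have "u \<in> set C" using that(1,4) C'(2) by auto
    then have "card {e\<in>E. u \<in> e} = 2" by (rule deg)
    moreover have "card {e, f, g} \<le> card {e\<in>E. u \<in> e}"
      using that finE by (intro card_mono) auto
    ultimately show False using that by simp
  qed
  have Mpos: "pos s u < K" if "e \<in> M" "u \<in> e" for e u
  proof -
    have "Max (pos s ` e) \<in> {1..<K}" using bij' that(1) by (auto simp: bij_betw_def)
    moreover have "finite e" using that(1) C'(4)[of e] by (auto simp: M_def)
    moreover from this have "pos s u \<le> Max (pos s ` e)" using that(2) by (intro Max_ge) auto
    ultimately show ?thesis by auto
  qed
  \<comment> \<open>Of the two edges at \<open>u\<close> at most one leads to \<open>a\<close>. The
    other has its label below \<open>K\<close>, which bounds the positions of both its ends.\<close>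
  have "u \<in> set s" if u: "u \<in> set C" "u \<noteq> a" for u
  proof -
    obtain e f where ef: "e \<in> E" "f \<in> E" "u \<in> e" "u \<in> f" "e \<noteq> f" using two[OF u(1)] by blast
    have "\<not> (a \<in> e \<and> a \<in> f)" using edge2[OF ef(1,3), of a] edge2[OF ef(2,4), of a] ef u(2) by auto
    then have "e \<in> M \<or> f \<in> M" using ef by (auto simp: M_def)
    then show ?thesis using Mpos ef pos_less_iff by (metis K_def)
  qed
  then have "set C \<subseteq> insert a (set s)" by auto
  moreover have "card (set C) = card (insert a (set s))"
    using dC ds as' lenC by (simp add: distinct_card K_def)
  ultimately have setC: "set C = set (a # s)"
    by (simp add: card_subset_eq)
  \<comment> \<open>Standardness of \<open>C\<close> enters here: with the vertex set known, its two
    greatest vertices are \<open>a\<close> and \<open>s ! 0\<close>.\<close>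
  have ab: "{a, s ! 0} \<in> E"
    using stC top unfolding standard_cycle_def Let_def C'(2) E_def[symmetric] setC top2_def by simp
  have parent: "\<exists>p<j. {s ! p, s ! j} \<in> M" if j: "j \<in> {1..<K}" for j
  proof -
    obtain e where e: "e \<in> M" "Max (pos s ` e) = j"
      using bij' j unfolding bij_betw_def by (metis (no_types, lifting) imageE)
    obtain u w where uw: "e = {u, w}" "u \<noteq> w" using C'(4)[of e] e(1) by (auto simp: M_def)
    then have us: "u \<in> set s" "w \<in> set s" using Mpos[OF e(1)] pos_less_iff by (auto simp: K_def)
    then have ne: "pos s u \<noteq> pos s w" using uw(2) nth_pos by metis
    have mx: "max (pos s u) (pos s w) = j" using e(2) uw(1) by simp
    show ?thesis
    proof (cases "pos s u < pos s w")
      case True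
      then show ?thesis using mx us nth_pos[of u s] nth_pos[of w s] e(1) uw(1)
        by (intro exI[of _ "pos s u"]) auto
    next
      case False
      then show ?thesis using mx us nth_pos[of u s] nth_pos[of w s] e(1) uw(1) ne
        by (intro exI[of _ "pos s w"]) (auto simp: insert_commute)
    qed
  qed
  then obtain p where p: "\<And>j. j \<in> {1..<K} \<Longrightarrow> p j < j \<and> {s ! p j, s ! j} \<in> M" by metis
  have sinj: "s ! i = s ! j \<longleftrightarrow> i = j" if "i < K" "j < K" for i j
    using that ds by (simp add: nth_eq_iff_index_eq K_def)
  have pinj: "i = j" if ij: "i \<in> {1..<K}" "j \<in> {1..<K}" "p i = p j" "i \<le> j" for i j
  proof (rule ccontr)
    assume "i \<noteq> j"
    define m where "m = p i"
    have m: "m < i" "m < j" and e: "{s ! m, s ! i} \<in> E" "{s ! m, s ! j} \<in> E"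
      using p[OF ij(1)] p[OF ij(2)] ij(3) by (auto simp: m_def M_def)
    have ne: "{s ! m, s ! i} \<noteq> {s ! m, s ! j}"
      using m ij sinj \<open>i \<noteq> j\<close> by (auto simp: doubleton_eq_iff)
    \<comment> \<open>A third edge at \<open>s ! m\<close> contradicts degree two: the edge to
      \<open>a\<close> if \<open>m = 0\<close>, the edge to its own parent otherwise.\<close>
    show False
    proof (cases "m = 0")
      case True
      have "a \<noteq> s ! i" "a \<noteq> s ! j" using as' ij by (auto simp: K_def)
      then show False
        using at_most_two[OF e ab, of "s ! 0"] ne True ij sinj[of 0 i] sinj[of 0 j] m by (auto simp: doubleton_eq_iff)
    next
      case False
      then have mm: "m \<in> {1..<K}" using m ij by auto
      have "{s ! p m, s ! m} \<in> E" "p m < m" using p[OF mm] by (auto simp: M_def)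
      then show False
        using at_most_two[OF e, of "{s ! p m, s ! m}" "s ! m"] ne m ij sinj mm by (auto simp: doubleton_eq_iff)
    qed
  qed
  have pj: "p j = j - 1" if "j \<in> {1..<K}" for j
    using that
  proof (induction j rule: less_induct)
    case (less j)
    show ?case
    proof (rule ccontr)
      assume ne: "p j \<noteq> j - 1"
      \<comment> \<open>If the parent of \<open>j\<close> came before \<open>j - 1\<close>, the
        vertex right after that parent would, by induction, have the same parent.\<close>
      define i where "i = Suc (p j)"
      have i: "i \<in> {1..<K}" "i < j" using p[OF less.prems] ne less.prems by (auto simp: i_def)
      then have "p i = p j" using less.IH[OF i(2,1)] by (simp add: i_def)
      then show False using pinj[OF i(1) less.prems] i(2) by simp
    qed
  qed
  have path: "{s ! (j - 1), s ! j} \<in> E" if "j \<in> {1..<K}" for j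
    using p[OF that] pj[OF that] by (simp add: M_def)
  \<comment> \<open>Two edges avoiding \<open>a\<close> at the last vertex would both carry the
    label \<open>K - 1\<close>, so one of its edges leads to \<open>a\<close>.\<close>
  have last: "{s ! (K - 1), a} \<in> E"
  proof -
    have K1: "K - 1 \<in> {1..<K}" using K by auto
    have lC: "s ! (K - 1) \<in> set C" using setC K by (simp add: K_def)
    have mxl: "Max (pos s ` e) = K - 1" if "e \<in> M" "s ! (K - 1) \<in> e" for e
    proof (rule Max_eqI)
      show "finite (pos s ` e)" using that(1) C'(4)[of e] by (auto simp: M_def)
      show "y \<le> K - 1" if "y \<in> pos s ` e" for y using that Mpos[OF \<open>e \<in> M\<close>] by fastforce
      show "K - 1 \<in> pos s ` e"
        using that(2) pos_nth[OF ds, of "K - 1"] K by (force simp: K_def)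
    qed
    obtain e f where ef: "e \<in> E" "f \<in> E" "s ! (K - 1) \<in> e" "s ! (K - 1) \<in> f" "e \<noteq> f" using two[OF lC] by blast
    have "\<not> (e \<in> M \<and> f \<in> M)"
    proof
      assume M: "e \<in> M \<and> f \<in> M"
      then have "Max (pos s ` e) = Max (pos s ` f)" using mxl[of e] mxl[of f] ef by simp
      then show False using inj_onD[OF bij_betw_imp_inj_on[OF bij']] M ef(5) by blast
    qed
    then have "a \<in> e \<or> a \<in> f" using ef by (auto simp: M_def)
    moreover have "a \<noteq> s ! (K - 1)" using as' K by (auto simp: K_def)
    ultimately show ?thesis using edge2[OF ef(1,3)] edge2[OF ef(2,4)] ef by metis
  qed
  have "cycle_of (a # s) \<subseteq> E"
    unfolding cycle_of_Cons[OF as] using ab last path by (auto simp: K_def)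
  moreover have "card (cycle_of (a # s)) = card E"
    using cycle_of_simps(1)[OF as] C'(1) lenC by (simp add: K_def)
  ultimately show ?thesis using finE by (metis E_def card_subset_eq)
qed

lemma bij_cycle_of_Cons:
  assumes as: "is_circuit n (a # s)"
  shows "bij_betw (\<lambda>e. Max (pos s ` e)) {e\<in>cycle_of (a # s). a \<notin> e} {1..<length s}"
proof -
  have ds: "distinct s" and as': "a \<notin> set s" using as by (auto simp: is_circuit_def)
  let ?f = "\<lambda>j. {s ! (j - 1), s ! j}"
  have eq: "{e\<in>cycle_of (a # s). a \<notin> e} = ?f ` {1..<length s}"
  proof -
    have "a \<noteq> s ! i" if "i < length s" for i using as' that nth_mem by metis
    then have "a \<notin> ?f j" if "j \<in> {1..<length s}" for j using that by (simp add: less_imp_diff_less)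
    then show ?thesis unfolding cycle_of_Cons[OF as] by blast
  qed
  have mx: "Max (pos s ` ?f j) = j" if "j \<in> {1..<length s}" for j
  proof -
    have "j - 1 < length s" using that by auto
    then show ?thesis using that by (simp add: pos_nth[OF ds])
  qed
  show ?thesis
    unfolding eq
    by (rule bij_betwI[where g = ?f]) (use mx in auto)
qed

subsection \<open>Dual functionals of standard circuits\<close>

text \<open>A vertex outside \<open>s\<close> has position \<open>length s\<close>, so every generator that is to be sent to \<open>0\<close> gets the
  out-of-range label \<open>length s\<close>.\<close>
definition path_label :: "(nat \<Rightarrow> gen) \<Rightarrow> nat \<Rightarrow> nat list \<Rightarrow> gen \<Rightarrow> nat" where
  "path_label v a s g = (case g of W i j \<Rightarrow> max (pos s i) (pos s j) | _ \<Rightarrow> if g = v a then 0 else length s)"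

lemma path_label_egW: "path_label v a s (egW i j) = max (pos s i) (pos s j)"
  by (simp add: path_label_def egW_def)

lemma letter_eq_iff: "letter v \<Longrightarrow> letter v' \<Longrightarrow> v' u = v a \<longleftrightarrow> v' = v \<and> u = a"
  by (auto simp: letter_def fun_eq_iff)

lemma path_label_letter: "letter v \<Longrightarrow> letter v' \<Longrightarrow> path_label v a s (v' u) = (if v' = v \<and> u = a then 0 else length s)"
  using letter_eq_iff[of v v' u a] by (auto simp: path_label_def letter_def)

text \<open>The only letter in range is \<open>v a\<close>, and its vertex, lying outside
  \<open>s\<close>, has position \<open>length s\<close>; letters at vertices of smaller position
  are out of range.\<close>

lemma label_functional_path_label_Ideal:
  assumes "letter v" "a \<notin> set s" "f \<in> Ideal n"
  shows "label_functional n (path_label v a s) (length s) f = 0"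
proof (rule label_functional_Ideal[where pos = "pos s"])
  fix v' i assume "letter v'" "pos s i < length s"
  then show "length s \<le> path_label v a s (v' i)"
    using assms pos_less_iff[of s i] by (auto simp: path_label_letter)
qed (simp_all add: path_label_egW assms)

lemma egW_eq_iff: "egW i j = egW i' j' \<longleftrightarrow> {i, j} = {i', j'}"
  by (auto simp: egW_def doubleton_eq_iff min_def max_def)

lemma cedge_eq_iff: "cedge C m = cedge C m' \<longleftrightarrow> edge_at C m = edge_at C m'"
  by (simp add: cedge_def edge_at_def egW_eq_iff)

text \<open>Each monomial contains a single letter, which must be \<open>v a\<close> and takes label
  0, so the edges have to supply the labels from 1 on. The edge \<open>i\<close> has distinct ends,
  hence at most one part of its difference contributes and nothing cancels.\<close>

lemma label_functional_term:
  assumes C: "is_circuit n C" and ij: "i < j" "j < length C" and v: "letter v" "letter v'" and K: "s \<noteq> []"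
  defines "I \<equiv> {..<length C} - {i, j}"
  shows "label_functional n (path_label v a s) (length s) (emul (edge_difference v' C i) (omega_minus C i j)) \<noteq> 0
    \<longleftrightarrow> v' = v \<and> a \<in> edge_at C i \<and> bij_betw (path_label v a s) (cedge C ` I) {1..<length s}"
proof -
  define gs where "gs = map (cedge C) (filter (\<lambda>m. m \<noteq> i \<and> m \<noteq> j) [0..<length C])"
  have om: "omega_minus C i j = eprod (map egen gs)"
    by (simp add: omega_minus_def gs_def omega_c_cedge o_def)
  have set_gs: "set gs = cedge C ` I" by (auto simp: gs_def I_def)
  have "inj_on (cedge C) {..<length C}"
    using inj_on_edge_at[OF C] by (simp add: inj_on_def cedge_eq_iff)
  then have "inj_on (cedge C) (set (filter (\<lambda>m. m \<noteq> i \<and> m \<noteq> j) [0..<length C]))"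
    by (rule inj_on_subset) auto
  then have d: "distinct gs" by (simp add: gs_def distinct_map)
  have notin: "v' u \<notin> set gs" for u
    using v by (auto simp: set_gs cedge_def egW_def letter_def)
  have G: "set gs \<subseteq> Gens n" by (auto simp: set_gs I_def intro: cedge_Gens[OF C])
  let ?F = "label_functional n (path_label v a s) (length s)"
  have val: "?F (emul (egen (v' u)) (eprod (map egen gs))) \<noteq> 0
      \<longleftrightarrow> v' = v \<and> u = a \<and> bij_betw (path_label v a s) (cedge C ` I) {1..<length s}"
    if "u \<in> {1..n}" for u
  proof -
    have eq: "{..<length s} = insert 0 {1..<length s}" using K by auto
    have "bij_betw (path_label v a s) (insert (v' u) (set gs)) {..<length s}
      \<longleftrightarrow> v' = v \<and> u = a \<and> bij_betw (path_label v a s) (set gs) {1..<length s}"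
    proof (cases "v' = v \<and> u = a")
      case True
      then have 0: "path_label v a s (v' u) = 0" using v by (simp add: path_label_letter)
      have "bij_betw (path_label v a s) (set gs) {1..<length s} = bij_betw (path_label v a s) (insert (v' u) (set gs)) {..<length s}"
        using notIn_Un_bij_betw3[OF notin, of "path_label v a s" u "{1..<length s}"] by (simp add: 0 eq)
      then show ?thesis using True by simp
    next
      case False
      then have "path_label v a s (v' u) = length s" using v by (auto simp: path_label_letter)
      then show ?thesis using False by (auto simp: bij_betw_def)
    qed
    then show ?thesis using label_functional_egen_eprod[OF d notin, of u n] G that v by (simp add: set_gs)
  qed
  have V: "csrc C i \<in> {1..n}" "ctgt C i \<in> {1..n}" "csrc C i \<noteq> ctgt C i"
    using circuit_verts[OF C, of i] ij by auto
  have "?F (emul (edge_difference v' C i) (omega_minus C i j)) = ?F (emul (egen (v' (ctgt C i))) (eprod (map egen gs)))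
     - ?F (emul (egen (v' (csrc C i))) (eprod (map egen gs)))"
    by (simp only: edge_difference_def om emul_diff_left label_functional_diff)
  then show ?thesis
    using val[OF V(1)] val[OF V(2)] V(3) by (auto simp: edge_at_def)
qed

text \<open>An undeleted edge at \<open>a\<close> would have a label out of range, so the deleted
  pair is exactly the set \<open>R\<close> of the two edges at \<open>a\<close>. At most one summand
  is therefore nonzero, and the claim reduces to the combinatorics of the cycle.\<close>

lemma label_functional_cycle_elt:
  assumes C: "is_circuit n C" "standard_cycle (cycle_of C)"
    and as: "is_circuit n (a # s)" "top2 a s" and v: "letter v" "letter v'"
  shows "label_functional n (path_label v a s) (length s) (cycle_elt v' C) \<noteq> 0 \<longleftrightarrow> v' = v \<and> cycle_of C = cycle_of (a # s)"
proof -
  let ?F = "label_functional n (path_label v a s) (length s)" and ?k = "length C"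
  have s: "s \<noteq> []" and a: "a \<notin> set s" using as by (auto simp: is_circuit_def)
  have posa: "pos s a = length s" using a pos_less_iff[of s a] pos_le[of s a] by auto
  let ?P = "{(i, j). i < j \<and> j < ?k}"
  have finP: "finite ?P" by (rule finite_subset[of _ "{..<?k} \<times> {..<?k}"]) auto
  define trm where "trm i j = ?F (emul (edge_difference v' C i) (omega_minus C i j))" for i j
  have F: "?F (cycle_elt v' C) = (\<Sum>(i, j)\<in>?P. (-1) ^ (i + j) * trm i j)"
    unfolding cycle_elt_def label_functional_sum trm_def by (rule sum.cong) (auto simp: label_functional_sc)
  define R where "R = {m. m < ?k \<and> a \<in> edge_at C m}"
  \<comment> \<open>Generators are traded for edges as vertex sets; in this form the condition
    depends only on the cycle, not on the circuit that traverses it.\<close>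
  have bij: "bij_betw (path_label v a s) (cedge C ` ({..<?k} - R)) {1..<length s}
     \<longleftrightarrow> bij_betw (\<lambda>e. Max (pos s ` e)) {e\<in>cycle_of C. a \<notin> e} {1..<length s}"
  proof -
    let ?I = "{..<?k} - R"
    have ie: "inj_on (edge_at C) ?I" by (rule inj_on_subset[OF inj_on_edge_at[OF C(1)]]) auto
    then have ic: "inj_on (cedge C) ?I" by (simp add: inj_on_def cedge_eq_iff)
    have im: "{e\<in>cycle_of C. a \<notin> e} = edge_at C ` ?I" by (auto simp: cycle_of_edge_at R_def)
    have "(path_label v a s \<circ> cedge C) = ((\<lambda>e. Max (pos s ` e)) \<circ> edge_at C)"
      by (auto simp: fun_eq_iff cedge_def path_label_egW edge_at_def)
    then show ?thesis
      unfolding im bij_betw_comp_iff[OF inj_on_imp_bij_betw[OF ie]] bij_betw_comp_iff[OF inj_on_imp_bij_betw[OF ic]]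
      by simp
  qed
  have nz: "trm i j \<noteq> 0 \<longleftrightarrow> v' = v \<and> {i, j} = R \<and> bij_betw (path_label v a s) (cedge C ` ({..<?k} - R)) {1..<length s}"
    if "i < j" "j < ?k" for i j
  proof
    assume "trm i j \<noteq> 0"
    then have t: "v' = v" "a \<in> edge_at C i" "bij_betw (path_label v a s) (cedge C ` ({..<?k} - {i, j})) {1..<length s}"
      using label_functional_term[OF C(1) that v s, of a] unfolding trm_def by blast+
    have "a \<notin> edge_at C m" if m: "m < ?k" "m \<notin> {i, j}" for m
    proof
      assume "a \<in> edge_at C m"
      then have "path_label v a s (cedge C m) \<ge> length s" using posa by (auto simp: cedge_def path_label_egW edge_at_def)
      moreover have "path_label v a s (cedge C m) \<in> {1..<length s}"
        using t(3) m unfolding bij_betw_def by blast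
      ultimately show False by simp
    qed
    then have sub: "R \<subseteq> {i, j}" by (auto simp: R_def)
    have "a \<in> set C" using t(2) that cycle_of_simps(2)[OF C(1)] by (auto simp: cycle_of_edge_at)
    then have "card R = 2" using circuit_degree_index[OF C(1)] by (simp add: R_def)
    then have "R = {i, j}" using that by (intro card_subset_eq sub) auto
    then show "v' = v \<and> {i, j} = R \<and> bij_betw (path_label v a s) (cedge C ` ({..<?k} - R)) {1..<length s}"
      using t by simp
  next
    \<comment> \<open>The linear factor always belongs to the earlier deleted edge; this one
      contains \<open>a\<close> in any case, since both do.\<close>
    assume r: "v' = v \<and> {i, j} = R \<and> bij_betw (path_label v a s) (cedge C ` ({..<?k} - R)) {1..<length s}"
    then have "a \<in> edge_at C i" by (auto simp: R_def)
    then show "trm i j \<noteq> 0" using r label_functional_term[OF C(1) that v s, of a] unfolding trm_def by blast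
  qed
  show ?thesis
  proof
    assume "?F (cycle_elt v' C) \<noteq> 0"
    then obtain x where x: "x \<in> ?P" "(case x of (i, j) \<Rightarrow> (-1) ^ (i + j) * trm i j) \<noteq> 0"
      unfolding F by (meson sum.neutral)
    then obtain i j where ij: "i < j" "j < ?k" "trm i j \<noteq> 0" by auto
    then have n: "v' = v" "{i, j} = R" "bij_betw (\<lambda>e. Max (pos s ` e)) {e\<in>cycle_of C. a \<notin> e} {1..<length s}"
      using nz[OF ij(1,2)] bij by blast+
    have "a \<in> \<Union>(cycle_of C)" using n(2) by (auto simp: R_def cycle_of_edge_at)
    then have "a \<in> set C" using cycle_of_simps(2)[OF C(1)] by simp
    then show "v' = v \<and> cycle_of C = cycle_of (a # s)"
      using n cycle_eq_of_bij[OF C _ as] by blast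
  next
    assume r: "v' = v \<and> cycle_of C = cycle_of (a # s)"
    then have "set C = set (a # s)" using cycle_of_simps(2)[OF C(1)] cycle_of_simps(2)[OF as(1)] by simp
    then have "card R = 2" unfolding R_def by (intro circuit_degree_index[OF C(1)]) auto
    then obtain i0 j0 where R: "R = {i0, j0}" "i0 < j0"
      unfolding card_2_iff by (metis insert_commute linorder_neqE_nat)
    then have lt: "j0 < ?k" by (auto simp: R_def)
    have b: "bij_betw (path_label v a s) (cedge C ` ({..<?k} - R)) {1..<length s}"
      unfolding bij using bij_cycle_of_Cons[OF as(1)] r by simp
    have "?F (cycle_elt v' C) = (\<Sum>(i, j)\<in>{(i0, j0)}. (-1) ^ (i + j) * trm i j)"
      unfolding F
    proof (rule sum.mono_neutral_right[OF finP], goal_cases)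
      case 1 show ?case using R(2) lt by auto
    next
      case 2
      have "trm i j = 0" if "i < j" "j < ?k" "(i, j) \<noteq> (i0, j0)" for i j
        using nz[OF that(1,2)] that R by (auto simp: doubleton_eq_iff)
      then have "(case x of (i, j) \<Rightarrow> (-1) ^ (i + j) * trm i j) = 0" if "x \<in> ?P - {(i0, j0)}" for x
        using that by (cases x) simp
      then show ?case by blast
    qed
    also have "\<dots> \<noteq> 0" using nz[OF R(2) lt] r b R(1) by simp
    finally show "?F (cycle_elt v' C) \<noteq> 0" .
  qed
qed

section \<open>Normal forms of standard circuits\<close>

lemma cycle_of_rotate1: "cycle_of (rotate1 vs) = cycle_of vs"
proof -
  let ?k = "length vs"
  have e: "edge_at (rotate1 vs) m = edge_at vs (Suc m mod ?k)" if "m < ?k" for m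
  proof -
    have "Suc m mod ?k < ?k" using that by (intro mod_less_divisor) linarith
    then show ?thesis using that by (simp add: edge_at_def csrc_def ctgt_def nth_rotate1 mod_Suc_eq)
  qed
  have "(\<lambda>m. Suc m mod ?k) ` {..<?k} = {..<?k}"
  proof (rule endo_inj_surj)
    show "inj_on (\<lambda>m. Suc m mod ?k) {..<?k}"
      by (auto simp: inj_on_def mod_Suc split: if_splits)
    show "(\<lambda>m. Suc m mod ?k) ` {..<?k} \<subseteq> {..<?k}"
      by (auto intro!: mod_less_divisor)
  qed simp
  then have "edge_at vs ` {..<?k} = (\<lambda>m. edge_at vs (Suc m mod ?k)) ` {..<?k}" by (metis image_image)
  also have "\<dots> = edge_at (rotate1 vs) ` {..<?k}" using e by auto
  finally show ?thesis by (simp add: cycle_of_edge_at)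
qed

lemma cycle_of_rotate: "cycle_of (rotate m vs) = cycle_of vs"
  by (induction m) (simp_all add: cycle_of_rotate1)

lemma cycle_of_rev: "cycle_of (rev vs) = cycle_of vs"
proof -
  let ?k = "length vs"
  have sub: "cycle_of (rev us) \<subseteq> cycle_of us" for us :: "nat list"
  proof
    let ?k = "length us"
    fix e assume "e \<in> cycle_of (rev us)"
    then obtain m where m: "m < ?k" "e = edge_at (rev us) m" by (auto simp: cycle_of_edge_at)
    show "e \<in> cycle_of us"
    proof (cases "Suc m = ?k")
      case True
      have "rev us ! m = us ! 0" "rev us ! 0 = us ! (?k - 1)"
        using m(1) True rev_nth[of m us] rev_nth[of 0 us] by (cases us; auto)+
      moreover have "?k - 1 + 1 = ?k" using m(1) by linarith
      then have "(?k - 1 + 1) mod ?k = 0" by simp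
      ultimately have "e = edge_at us (?k - 1)" using m True
        by (simp add: edge_at_def csrc_def ctgt_def insert_commute)
      then show ?thesis using m by (auto simp: cycle_of_edge_at)
    next
      case False
      then have "Suc (?k - Suc (Suc m)) = ?k - Suc m" using m by linarith
      then have "e = edge_at us (?k - Suc (Suc m))" using m False
        by (auto simp: edge_at_def csrc_def ctgt_def rev_nth)
      then show ?thesis using m by (auto simp: cycle_of_edge_at)
    qed
  qed
  from sub[of vs] sub[of "rev vs"] show ?thesis by auto
qed

text \<open>The edge between the two greatest vertices is rotated to the front. If it is traversed
  towards the greatest vertex, reversing the circuit and rotating once more corrects the
  direction.\<close>

lemma circuit_rep:
  assumes C: "is_circuit n C" "standard_cycle (cycle_of C)"
  shows "\<exists>a s. is_circuit n (a # s) \<and> top2 a s \<and> cycle_of (a # s) = cycle_of C"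
proof -
  define a where "a = Max (set C)"
  define b where "b = Max (set C - {a})"
  let ?k = "length C"
  have k: "?k \<ge> 3" using C by (simp add: is_circuit_def)
  have "{a, b} \<in> cycle_of C"
    using C(2) unfolding standard_cycle_def Let_def cycle_of_simps(2)[OF C(1)] a_def b_def .
  then obtain m where m: "m < ?k" "{a, b} = {C ! m, C ! ((m + 1) mod ?k)}"
    by (auto simp: cycle_of_def csrc_def ctgt_def)
  define D where "D = rotate m C"
  have lenD: "length D = ?k" by (simp add: D_def)
  then obtain u w t where D: "D = u # w # t" using k by (metis Suc_le_length_iff numeral_3_eq_3)
  have "D ! 0 = C ! m" "D ! 1 = C ! ((m + 1) mod ?k)"
  proof -
    have "0 < ?k" "1 < ?k" using k by linarith+
    then show "D ! 0 = C ! m" "D ! 1 = C ! ((m + 1) mod ?k)"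
      unfolding D_def using nth_rotate[of 0 C m] nth_rotate[of 1 C m] m(1) by simp_all
  qed
  then have uw: "{a, b} = {u, w}" using m(2) by (simp add: D)
  have res: "?thesis" if "vs = a # b # t'" "cycle_of vs = cycle_of C" "is_circuit n vs" "set vs = set C" for vs t'
  proof (intro exI conjI)
    show "is_circuit n (a # b # t')" "cycle_of (a # b # t') = cycle_of C" using that by auto
    show "top2 a (b # t')" using that by (auto simp: top2_def a_def b_def)
  qed
  have circD: "is_circuit n D" using C(1) by (simp add: D_def is_circuit_def)
  have setD: "set D = set C" by (simp add: D_def)
  have cycD: "cycle_of D = cycle_of C" by (simp add: D_def cycle_of_rotate)
  show ?thesis
  proof (cases "a = u")
    case True
    then have "b = w" using uw by (auto simp: doubleton_eq_iff)
    then show ?thesis using True D circD setD cycD by (intro res[of D t]) simp_all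
  next
    case False
    then have ab: "a = w" "b = u" using uw by (auto simp: doubleton_eq_iff)
    have "rotate (length t) (rev D) = a # b # rev t"
      using rotate_append[of "rev t" "[w, u]"] by (simp add: D ab)
    moreover have "is_circuit n (rotate (length t) (rev D))" using circD by (simp add: is_circuit_def)
    moreover have "cycle_of (rotate (length t) (rev D)) = cycle_of C"
      by (simp add: cycle_of_rotate cycle_of_rev cycD)
    moreover have "set (rotate (length t) (rev D)) = set C" by (simp add: setD)
    ultimately show ?thesis by (intro res[of "rotate (length t) (rev D)" "rev t"])
  qed
qed

text \<open>The first two entries fix starting point and direction; from then on the next vertex is
  the neighbour that was not just left. Normal forms of a cycle are thus unique.\<close>

lemma circuit_eq_of_cycle_eq:
  assumes vs: "is_circuit n (a # b # t)" "is_circuit n (a # b # t')"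
    and eq: "cycle_of (a # b # t) = cycle_of (a # b # t')"
  shows "t = t'"
proof -
  let ?v = "a # b # t" and ?w = "a # b # t'"
  have len: "length ?v = length ?w"
    using cycle_of_simps(1)[OF vs(1)] cycle_of_simps(1)[OF vs(2)] eq by simp
  define k where "k = length ?v"
  have k: "k \<ge> 3" "length ?w = k" using vs len by (auto simp: is_circuit_def k_def)
  have d: "distinct ?v" "distinct ?w" using vs by (auto simp: is_circuit_def)
  have "?v ! i = ?w ! i" if "i < k" for i
    using that
  proof (induction i rule: less_induct)
    case (less i)
    consider "i = 0" | "i = 1" | "i \<ge> 2" by linarith
    then show ?case
    proof cases
      case 3
      have "edge_at ?v (i - 1) \<in> cycle_of ?v" using less.prems by (auto simp: cycle_of_edge_at k_def)
      then obtain m where m: "m < k" "edge_at ?v (i - 1) = edge_at ?w m"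
        unfolding eq using k by (auto simp: cycle_of_edge_at)
      have e: "edge_at ?v (i - 1) = {?v ! (i - 1), ?v ! i}"
        using 3 less.prems by (simp add: edge_at_def csrc_def ctgt_def k_def)
      have IH: "?v ! (i - 1) = ?w ! (i - 1)" "?v ! (i - 2) = ?w ! (i - 2)"
        using less.IH[of "i - 1"] less.IH[of "i - 2"] 3 less.prems by auto
      have lt: "(m + 1) mod k < k" using k(1) by (intro mod_less_divisor) linarith
      have w: "edge_at ?w m = {?w ! m, ?w ! ((m + 1) mod k)}"
        using k(2) by (simp add: edge_at_def csrc_def ctgt_def)
      have "{?w ! (i - 1), ?v ! i} = {?w ! m, ?w ! ((m + 1) mod k)}"
        using m(2) unfolding e w IH(1) .
      then consider "?w ! (i - 1) = ?w ! m" "?v ! i = ?w ! ((m + 1) mod k)"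
        | "?w ! (i - 1) = ?w ! ((m + 1) mod k)" "?v ! i = ?w ! m"
        unfolding doubleton_eq_iff by blast
      then show ?thesis
      proof cases
        case 1
        have "i - 1 = m" using 1(1) d(2) m(1) less.prems k(2) by (metis less_imp_diff_less nth_eq_iff_index_eq)
        then have "(m + 1) mod k = i" using 3 less.prems by simp
        then show ?thesis using 1 by simp
      next
        \<comment> \<open>Traversing the shared edge backwards would make the next vertex the one
          two steps earlier, against distinctness.\<close>
        case 2
        have "i - 1 = (m + 1) mod k" using 2(1) d(2) lt less.prems k(2) by (metis less_imp_diff_less nth_eq_iff_index_eq)
        then have "m = i - 2" using 3 m(1) less.prems
          by (cases "m + 1 = k") auto
        then have "?v ! i = ?v ! (i - 2)" using 2 IH by simp
        moreover have "i < length ?v" "i - 2 < length ?v" using less.prems by (auto simp: k_def)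
        ultimately have "i = i - 2" using d(1) nth_eq_iff_index_eq by metis
        then show ?thesis using 3 by simp
      qed
    qed simp_all
  qed
  then have "?v = ?w" by (intro nth_equalityI len) (simp add: k_def)
  then show ?thesis by simp
qed

text \<open>Functionals that vanish on \<open>Z\<close> and are dual, up to nonzero scalars, to the
  \<open>e j\<close> keep these independent modulo \<open>Z\<close>. The finite spanning set
  \<open>B\<close> keeps all bases finite; \<open>ev.dim\<close> of an infinite-dimensional space
  would default to 0.\<close>

lemma dim_add_card_le:
  assumes "Z \<subseteq> V" "V \<subseteq> ev.span B" "finite B"
    and "finite J" "\<And>j. j \<in> J \<Longrightarrow> e j \<in> V"
    and add: "\<And>j f g. j \<in> J \<Longrightarrow> \<Phi> j (f + g) = \<Phi> j f + (\<Phi> j g :: rat)"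
    and sc: "\<And>j c f. j \<in> J \<Longrightarrow> \<Phi> j (sc c f) = c * \<Phi> j f"
    and Z: "\<And>j f. j \<in> J \<Longrightarrow> f \<in> Z \<Longrightarrow> \<Phi> j f = 0"
    and dual: "\<And>i j. i \<in> J \<Longrightarrow> j \<in> J \<Longrightarrow> \<Phi> j (e i) \<noteq> 0 \<longleftrightarrow> i = j"
  shows "ev.dim Z + card J \<le> ev.dim V"
proof -
  obtain BZ where BZ: "BZ \<subseteq> Z" "ev.independent BZ" "Z \<subseteq> ev.span BZ" "card BZ = ev.dim Z"
    using ev.basis_exists by blast
  have "BZ \<subseteq> ev.span B" using BZ(1) assms(1,2) by blast
  then have finBZ: "finite BZ" using ev.independent_span_bound[OF assms(3) BZ(2)] by blast
  have "ev.independent (BZ \<union> e ` I) \<and> card (BZ \<union> e ` I) = card BZ + card I" if "I \<subseteq> J" for I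
    using finite_subset[OF that assms(4)] that
  proof (induction I)
    case empty
    then show ?case using BZ by simp
  next
    case (insert j I)
    then have j: "j \<in> J" and IJ: "I \<subseteq> J" by auto
    \<comment> \<open>The kernel of \<open>\<Phi> j\<close> contains the basis of \<open>Z\<close>
      and all earlier vectors, but not \<open>e j\<close>.\<close>
    have "ev.span (BZ \<union> e ` I) \<subseteq> {f. \<Phi> j f = 0}"
    proof (rule ev.span_minimal)
      have "\<Phi> j (e i) = 0" if "i \<in> I" for i using dual[of i j] that insert.hyps(2) IJ j by auto
      then show "BZ \<union> e ` I \<subseteq> {f. \<Phi> j f = 0}" using Z[OF j] BZ(1) by auto
      have "\<Phi> j 0 = 0" using sc[OF j, of 0 0] by simp
      then show "ev.subspace {f. \<Phi> j f = 0}"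
        by (intro ev.subspaceI) (simp_all only: mem_Collect_eq add[OF j] sc[OF j] add_0 mult_zero_right)
    qed
    then have notin: "e j \<notin> ev.span (BZ \<union> e ` I)" using dual[OF j j] by auto
    then have "e j \<notin> BZ \<union> e ` I" by (meson ev.span_base)
    moreover have "finite (BZ \<union> e ` I)" using finBZ insert.hyps by simp
    moreover note insert.IH[OF IJ]
    moreover from this have "ev.independent (insert (e j) (BZ \<union> e ` I))"
      using ev.independent_insertI[OF notin] by blast
    moreover have "BZ \<union> e ` insert j I = insert (e j) (BZ \<union> e ` I)" by auto
    ultimately show ?case using insert.hyps by (simp only: card_insert_disjoint) simp
  qed
  from this[of J] have ind: "ev.independent (BZ \<union> e ` J)" and card: "card (BZ \<union> e ` J) = ev.dim Z + card J"
    using BZ(4) by auto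
  obtain BV where BV: "BV \<subseteq> V" "ev.independent BV" "V \<subseteq> ev.span BV" "card BV = ev.dim V"
    using ev.basis_exists by blast
  have "BV \<subseteq> ev.span B" using BV(1) assms(2) by blast
  then have "finite BV" using ev.independent_span_bound[OF assms(3) BV(2)] by blast
  moreover have "BZ \<union> e ` J \<subseteq> ev.span BV" using BZ(1) assms(1,5) BV(3) by blast
  ultimately show ?thesis
    using ev.independent_span_bound[OF _ ind, of BV] card BV(4) by auto
qed

subsection \<open>Dimension count\<close>

lemma finite_Lam_span: "\<exists>B. finite B \<and> Lam n \<subseteq> ev.span B"
proof (intro exI conjI subsetI)
  show "finite (mono ` Pow (Gens n))" by simp
  fix f assume f: "f \<in> Lam n"
  have "(\<Sum>U\<in>Pow (Gens n). sc (f U) (mono U)) \<in> ev.span (mono ` Pow (Gens n))"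
    by (intro ev.span_sum ev.span_scale ev.span_base imageI)
  then show "f \<in> ev.span (mono ` Pow (Gens n))" using Lam_mono_expansion[OF f] by simp
qed

lemma Lam_bideg_Lam: "Lam_bideg n p q \<subseteq> Lam n"
  by (auto simp: Lam_bideg_def Lam_def)

text \<open>A boundary would come from bidegree (-1, q + 1), where no monomial lives because a
  cardinality is never negative.\<close>

lemma Brep_1: "Brep n 1 q = Ideal n \<inter> Lam_bideg n 1 q"
proof -
  have "b = 0" if "b \<in> Lam_bideg n (1 - 2) (q + 1)" for b
  proof
    fix U
    show "b U = 0 U" using that by (force simp: Lam_bideg_def)
  qed
  moreover have "0 \<in> Lam_bideg n (1 - 2) (q + 1)" by (simp add: Lam_bideg_def)
  ultimately have "b \<in> Lam_bideg n (1 - 2) (q + 1) \<longleftrightarrow> b = 0" for b by blast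
  then show ?thesis by (auto simp: Brep_def)
qed

lemma Brep_1_subset_Zrep: "Brep n 1 q \<subseteq> Zrep n 1 q"
  by (auto simp: Brep_1 Zrep_def d2_Ideal)

lemma cycle_elt_Zrep:
  assumes "letter v" "is_circuit n C" "length C = q + 2"
  shows "cycle_elt v C \<in> Zrep n 1 q"
  using cycle_elt_bideg[OF assms(1,2)] d2_cycle_elt_Ideal[OF assms(1,2)] assms(3) by (simp add: Zrep_def)

lemma finite_circuits: "finite {C. is_circuit n C}"
  by (rule finite_subset[OF _ finite_subset_distinct[of "{1..n}"]]) (auto simp: is_circuit_def)

text \<open>A standard cycle is given by its vertex set together with an ordering of the vertices other
  than the two greatest.\<close>
lemma card_standard_circuits:
  assumes rep: "\<And>Z. is_cycle n Z \<Longrightarrow> standard_cycle Z \<Longrightarrow> \<exists>C\<in>CC. cycle_of C = Z"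
    and CC: "\<And>C. C \<in> CC \<Longrightarrow> is_circuit n C" and q: "q \<ge> 1"
  shows "(n choose (q + 2)) * fact q \<le> card {C\<in>CC. length C = q + 2}"
proof -
  define m2 where "m2 V = Max (V - {Max V})" for V :: "nat set"
  define vs where "vs = (\<lambda>(V, t). Max V # m2 V # t)"
  define D where "D = (SIGMA V:{V. V \<subseteq> {1..n} \<and> card V = q + 2}. permutations_of_set (V - {Max V, m2 V}))"
  have top: "Max V \<in> V" "m2 V \<in> V" "m2 V \<noteq> Max V" "finite V" if "V \<subseteq> {1..n}" "card V = q + 2" for V
  proof -
    show fin: "finite V" using that finite_subset by auto
    show "Max V \<in> V" using fin that by (intro Max_in) auto
    then have "card (V - {Max V}) = q + 1" using fin that by simp
    then have "V - {Max V} \<noteq> {}" by (metis add_is_0 card.empty one_neq_zero)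
    then have "m2 V \<in> V - {Max V}" unfolding m2_def using fin by (intro Max_in) auto
    then show "m2 V \<in> V" "m2 V \<noteq> Max V" by auto
  qed
  have props: "is_circuit n (vs x)" "set (vs x) = fst x" "standard_cycle (cycle_of (vs x))" "length (vs x) = q + 2"
    if x: "x \<in> D" for x
  proof -
    obtain V t where [simp]: "x = (V, t)" by (cases x)
    have V: "V \<subseteq> {1..n}" "card V = q + 2" and t: "set t = V - {Max V, m2 V}" "distinct t"
      using x by (auto simp: D_def permutations_of_set_def)
    note T = top[OF V]
    show set: "set (vs x) = fst x" using T t by (auto simp: vs_def)
    have dist: "distinct (vs x)" using T t by (auto simp: vs_def)
    then have "length (vs x) = card V" using distinct_card set by fastforce
    then show len: "length (vs x) = q + 2" using V by simp
    show circ: "is_circuit n (vs x)"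
      using dist set len V(1) q by (simp add: is_circuit_def)
    have "edge_at (vs x) 0 \<in> cycle_of (vs x)" using len by (simp add: cycle_of_edge_at)
    moreover have "edge_at (vs x) 0 = {Max V, m2 V}" by (simp add: edge_at_def csrc_def ctgt_def vs_def)
    ultimately show "standard_cycle (cycle_of (vs x))"
      unfolding standard_cycle_def Let_def cycle_of_simps(2)[OF circ] set by (simp add: m2_def)
  qed
  have "\<forall>x\<in>D. \<exists>C. C \<in> CC \<and> cycle_of C = cycle_of (vs x)"
  proof
    fix x assume x: "x \<in> D"
    have "is_cycle n (cycle_of (vs x))" using props(1)[OF x] by (auto simp: is_cycle_def)
    then show "\<exists>C. C \<in> CC \<and> cycle_of C = cycle_of (vs x)" using rep props(3)[OF x] by blast
  qed
  then obtain g where g: "\<And>x. x \<in> D \<Longrightarrow> g x \<in> CC \<and> cycle_of (g x) = cycle_of (vs x)" by metis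
  have "inj_on g D"
  proof (rule inj_onI)
    fix x y assume xy: "x \<in> D" "y \<in> D" "g x = g y"
    then have eq: "cycle_of (vs x) = cycle_of (vs y)" using g by metis
    have "set (vs x) = set (vs y)"
      using eq cycle_of_simps(2)[OF props(1)[OF xy(1)]] cycle_of_simps(2)[OF props(1)[OF xy(2)]] by simp
    then have fst: "fst x = fst y" using props(2) xy by simp
    then have "snd x = snd y"
      using circuit_eq_of_cycle_eq[of n "Max (fst x)" "m2 (fst x)" "snd x" "snd y"] eq props(1)[OF xy(1)] props(1)[OF xy(2)]
      by (auto simp: vs_def case_prod_unfold)
    with fst show "x = y" by (simp add: prod_eq_iff)
  qed
  moreover have "g ` D \<subseteq> {C\<in>CC. length C = q + 2}"
  proof
    fix C assume "C \<in> g ` D"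
    then obtain x where x: "x \<in> D" "C = g x" by auto
    then have "C \<in> CC" "cycle_of C = cycle_of (vs x)" using g by auto
    moreover from this have "length C = length (vs x)"
      using cycle_of_simps(1)[OF CC] cycle_of_simps(1)[OF props(1)[OF x(1)]] by metis
    ultimately show "C \<in> {C\<in>CC. length C = q + 2}" using props(4)[OF x(1)] by simp
  qed
  moreover have "finite {C\<in>CC. length C = q + 2}"
    by (rule finite_subset[OF _ finite_circuits[of n]]) (use CC in auto)
  ultimately have "card D \<le> card {C\<in>CC. length C = q + 2}" by (rule card_inj_on_le)
  moreover have "card D = (n choose (q + 2)) * fact q"
  proof -
    have fin: "finite {V. V \<subseteq> {1..n} \<and> card V = q + 2}" by simp
    have "card D = (\<Sum>V\<in>{V. V \<subseteq> {1..n} \<and> card V = q + 2}. card (permutations_of_set (V - {Max V, m2 V})))"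
      unfolding D_def using fin by (intro card_SigmaI) auto
    also have "\<dots> = (\<Sum>V\<in>{V. V \<subseteq> {1..n} \<and> card V = q + 2}. fact q)"
    proof (rule sum.cong)
      fix V assume "V \<in> {V. V \<subseteq> {1..n} \<and> card V = q + 2}"
      then have V: "V \<subseteq> {1..n}" "card V = q + 2" by auto
      note T = top[OF V]
      have "card (V - {Max V, m2 V}) = card V - card {Max V, m2 V}"
        using T by (intro card_Diff_subset) auto
      then have "card (V - {Max V, m2 V}) = q" using T V by auto
      then show "card (permutations_of_set (V - {Max V, m2 V})) = fact q" using T(4) by simp
    qed simp
    also have "\<dots> = (n choose (q + 2)) * fact q"
      using n_subsets[of "{1..n}" "q + 2"] by simp
    finally show ?thesis .
  qed
  ultimately show ?thesis by simp
qed

theorem theorem2p13: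
  fixes n :: nat and CC :: "nat list set"
  assumes "n \<ge> 3"
    and "\<forall>C\<in>CC. is_circuit n C \<and> standard_cycle (cycle_of C)"
    and "\<forall>Z. is_cycle n Z \<and> standard_cycle Z \<longrightarrow> (\<exists>!C. C \<in> CC \<and> cycle_of C = Z)"
  shows "LL_independent n CC
         \<and> (\<forall>q::nat. q \<ge> 1 \<longrightarrow> E3_dim n 1 q \<ge> 2 * (n choose (q + 2)) * fact q)"
proof -
  have CC: "is_circuit n C" "standard_cycle (cycle_of C)" if "C \<in> CC" for C using assms(2) that by auto
  have finCC: "finite CC" by (rule finite_subset[OF _ finite_circuits[of n]]) (use CC in auto)
  have inj: "C = C'" if "C \<in> CC" "C' \<in> CC" "cycle_of C = cycle_of C'" for C C'
    using assms(3) CC[OF that(1)] that unfolding is_cycle_def by metis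
  have "\<forall>C\<in>CC. \<exists>p. is_circuit n (fst p # snd p) \<and> top2 (fst p) (snd p) \<and> cycle_of (fst p # snd p) = cycle_of C"
    using circuit_rep CC by fastforce
  then obtain r where r: "\<And>C. C \<in> CC \<Longrightarrow> is_circuit n (fst (r C) # snd (r C)) \<and> top2 (fst (r C)) (snd (r C))
      \<and> cycle_of (fst (r C) # snd (r C)) = cycle_of C"
    by metis
  \<comment> \<open>The functional is read off the normal form \<open>r C\<close> instead of
    \<open>C\<close>, so the starting point and the direction chosen for \<open>C\<close> do not
    matter.\<close>
  define F where "F = (\<lambda>(C, v). label_functional n (path_label v (fst (r C)) (snd (r C))) (length (snd (r C))))"
  have F_Ideal: "F (C, v) f = 0" if "C \<in> CC" "letter v" "f \<in> Ideal n" for C v f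
    unfolding F_def using r[OF that(1)] that by (auto simp: is_circuit_def intro!: label_functional_path_label_Ideal)
  have F_cycle_elt: "F (C, v) (cycle_elt v' C') \<noteq> 0 \<longleftrightarrow> C' = C \<and> v' = v"
    if "C \<in> CC" "C' \<in> CC" "letter v" "letter v'" for C C' v v'
    unfolding F_def using label_functional_cycle_elt[OF CC[OF that(2)], of "fst (r C)" "snd (r C)" v v'] r[OF that(1)] inj that
    by auto
  have F_lin: "F x (f + g) = F x f + F x g" "F x (sc c f) = c * F x f" "F x (\<Sum>i\<in>I. h i) = (\<Sum>i\<in>I. F x (h i))"
    for x f g c and h :: "nat list \<Rightarrow> elt" and I
    by (simp_all only: F_def case_prod_unfold label_functional_add label_functional_sc label_functional_sum)
  have XY: "letter X" "letter Y" "X \<noteq> Y" by (auto simp: letter_def fun_eq_iff)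
  have "LL_independent n CC"
    unfolding LL_independent_def L_C_cycle_elt L'_C_cycle_elt
  proof (intro allI impI ballI)
    fix a b :: "nat list \<Rightarrow> rat" and C
    assume I: "(\<Sum>C\<in>CC. sc (a C) (cycle_elt X C) + sc (b C) (cycle_elt Y C)) \<in> Ideal n" and C: "C \<in> CC"
    have "(\<Sum>C'\<in>CC. a C' * F (C, v) (cycle_elt X C') + b C' * F (C, v) (cycle_elt Y C')) = 0" if "letter v" for v
      using F_Ideal[OF C that I] by (simp only: F_lin)
    \<comment> \<open>Pairing with the functional of \<open>C\<close> isolates its own summand; the
      letters X and Y then separate the two coefficients.\<close>
    then have sum0: "a C * F (C, v) (cycle_elt X C) + b C * F (C, v) (cycle_elt Y C) = 0" if v: "letter v" for v
    proof -
      have "(\<Sum>C'\<in>CC. a C' * F (C, v) (cycle_elt X C') + b C' * F (C, v) (cycle_elt Y C'))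
        = (\<Sum>C'\<in>{C}. a C' * F (C, v) (cycle_elt X C') + b C' * F (C, v) (cycle_elt Y C'))"
      proof (rule sum.mono_neutral_right[OF finCC])
        have "F (C, v) (cycle_elt X C') = 0" "F (C, v) (cycle_elt Y C') = 0" if "C' \<in> CC" "C' \<noteq> C" for C'
          using that F_cycle_elt[OF C _ v XY(1)] F_cycle_elt[OF C _ v XY(2)] by blast+
        then show "\<forall>C'\<in>CC - {C}. a C' * F (C, v) (cycle_elt X C') + b C' * F (C, v) (cycle_elt Y C') = 0" by simp
      qed (use C in simp)
      with \<open>\<And>v. letter v \<Longrightarrow> _ v = 0\<close>[OF v] show ?thesis by simp
    qed
    show "a C = 0 \<and> b C = 0"
      using sum0[OF XY(1)] sum0[OF XY(2)] F_cycle_elt[OF C C XY(1) XY(1)] F_cycle_elt[OF C C XY(1) XY(2)]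
        F_cycle_elt[OF C C XY(2) XY(1)] F_cycle_elt[OF C C XY(2) XY(2)] XY(3) by auto
  qed
  moreover have "E3_dim n 1 q \<ge> 2 * (n choose (q + 2)) * fact q" if q: "q \<ge> 1" for q
  proof -
    define J where "J = {C\<in>CC. length C = q + 2} \<times> {X, Y}"
    obtain B where B: "finite B" "Lam n \<subseteq> ev.span B" using finite_Lam_span by blast
    have J: "C \<in> CC" "length C = q + 2" "letter v" if "(C, v) \<in> J" for C v
      using that XY by (auto simp: J_def)
    \<comment> \<open>The additive form is what yields a bound for \<open>E3_dim\<close>, a
      truncated difference of natural numbers. The pairs in \<open>J\<close> provide the factor
      2.\<close>
    have "ev.dim (Brep n 1 q) + card J \<le> ev.dim (Zrep n 1 q)"
    proof (rule dim_add_card_le[where B = B and e = "\<lambda>(C, v). cycle_elt v C" and \<Phi> = F])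
      show "Brep n 1 q \<subseteq> Zrep n 1 q" by (rule Brep_1_subset_Zrep)
      show "Zrep n 1 q \<subseteq> ev.span B" using B(2) Lam_bideg_Lam[of n 1 q] by (auto simp: Zrep_def)
      show "finite J" using finCC by (simp add: J_def)
      show "(case j of (C, v) \<Rightarrow> cycle_elt v C) \<in> Zrep n 1 q" if "j \<in> J" for j
        using that J CC by (cases j) (auto intro!: cycle_elt_Zrep)
      show "F j f = 0" if "j \<in> J" "f \<in> Brep n 1 q" for j f
        using that J by (cases j) (auto simp: Brep_1 intro!: F_Ideal)
      show "F j (case i of (C, v) \<Rightarrow> cycle_elt v C) \<noteq> 0 \<longleftrightarrow> i = j" if "i \<in> J" "j \<in> J" for i j
        using that F_cycle_elt J by (cases i; cases j) auto
    qed (rule B F_lin)+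
    moreover have "card J = 2 * card {C\<in>CC. length C = q + 2}"
      using XY(3) by (simp add: J_def card_cartesian_product)
    moreover have "(n choose (q + 2)) * fact q \<le> card {C\<in>CC. length C = q + 2}"
      by (rule card_standard_circuits[OF _ CC(1) q]) (use assms(3) in blast)
    ultimately show ?thesis unfolding E3_dim_def by (simp add: algebra_simps)
  qed
  ultimately show ?thesis by blast
qed

end
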